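(* Let $H=\bigoplus_{i=1}^m H_i$ be the direct sum of separable real Hilbert spaces $H_1,\dots,H_m$, let $f\colon H\to\mathbb{R}$ be convex and differentiable, let $h_i\colon H_i\to\,]-\infty,+\infty]$ be proper, convex and lower semicontinuous for $i=1,\dots,m$, and set $h(x)=\sum_{i=1}^m h_i(x_i)$ and $F=f+h$. Let $\varepsilon=(\varepsilon_1,\dots,\varepsilon_m)$ be a $\{0,1\}^m$-valued random variable with $p_i:=\mathsf{P}(\varepsilon_i=1)>0$ for every $i$ and $\mathsf{P}(\varepsilon=(0,\dots,0))=0$, and let $(\varepsilon^n)_{n\in\mathbb{N}}$ be a sequence of independent copies of $\varepsilon$. Let $(\nu_i)_{1\le i\le m}\in\,]0,+\infty[^m$ be such that $$(\forall x,v\in H)\quad \mathsf{E}[f(x+\varepsilon\odot v)]\le f(x)+\mathsf{E}[\langle\nabla f(x),\varepsilon\odot v\rangle]+\frac12\sum_{i=1}^m p_i\nu_i\|v_i\|^2 .$$ Let $0<\gamma_i<2/\nu_i$ for every $i\in\{1,\dots,m\}$, let $x^0\in\operatorname{dom}h$ be deterministic, and let $(x^n)_{n\in\mathbb{N}}$ be the sequence of $H$-valued random variables defined by $$x_i^{n+1}=x_i^n+\varepsilon_i^n\big(\mathrm{prox}_{\gamma_i h_i}(x_i^n-\gamma_i\nabla_i f(x^n))-x_i^n\big),\qquad i=1,\dots,m,\ n\in\mathbb{N}.$$ Set $\delta=\max_{i}\gamma_i\nu_i$, $p_{\min}=\min_{i}p_i$, $F_*=\inf F$ and $S_*=\operatorname{argmin}F$.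 Suppose that $S_*\neq\varnothing$ and that there are a set $X\subset H$ with $\{x^n\mid n\in\mathbb{N}\}\subset X$ $\mathsf{P}$-a.s. and a constant $c>0$ such that $$(\forall x\in X)\quad \mathrm{dist}_{\Gamma^{-1}}(x,S_* )\le c\,\big\|x-\big(\mathrm{prox}_{\gamma_ih_i}(x_i-\gamma_i\nabla_if(x))\big)_{1\le i\le m}\big\|_{\Gamma^{-1}} .$$ Then, for every $n\in\mathbb{N}$, $$\mathsf{E}[F(x^n)]-F_*\le\Big(1-p_{\min}\min\Big\{1,\frac{2-\delta}{2c}\Big\}\Big)^n\big(\mathsf{E}[F(x^0)]-F_*\big).$$ Moreover, there exists a random variable $x_*$ taking values in $S_*$ such that $x^n\to x_*$ (strongly) $\mathsf{P}$-a.s. and $$\mathsf{E}[\|x^n-x_*\|_W]=O\Big(\big(1-p_{\min}\min\{1,(2-\delta)/(2c)\}\big)^{n/2}\Big).$$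
   Context: $H=\bigoplus_i H_i$ carries the inner product $\langle x,y\rangle=\sum_{i=1}^m\langle x_i,y_i\rangle$; $\nabla_i f(x)\in H_i$ is the $i$-th component of $\nabla f(x)$. For $v\in H$ and $\epsilon\in\{0,1\}^m$, $\epsilon\odot v=(\epsilon_iv_i)_{1\le i\le m}\in H$. For a proper convex lower semicontinuous function $\varphi$ on a Hilbert space, $\mathrm{prox}_\varphi(x)=\operatorname{argmin}_z\ \varphi(z)+\frac12\|x-z\|^2$. The weighted norms are $\|x\|_{\Gamma^{-1}}^2=\sum_{i=1}^m\frac1{\gamma_i}\|x_i\|^2$ and $\|x\|_W^2=\sum_{i=1}^m\frac{1}{\gamma_ip_i}\|x_i\|^2$, and $\mathrm{dist}_{\Gamma^{-1}}(x,S)=\inf_{z\in S}\|x-z\|_{\Gamma^{-1}}$. *)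

theory Defs
  imports "HOL-Probability.Probability" "HOL-Library.Landau_Symbols"
begin

text \<open>
  The Hilbert spaces \<open>H\<^sub>i\<close> may differ from each other. They are given as closed subspaces \<open>V i\<close>
  of one separable Hilbert space \<open>'a\<close> (any finite family of separable Hilbert spaces embeds
  isometrically into such a space), and functions on \<open>H\<^sub>i\<close> are only ever inspected on \<open>V i\<close>.
  The inner product of the type \<open>'a ^ 'm\<close> is the sum of the componentwise inner products.
\<close>

definition direct_sum :: "('m::finite \<Rightarrow> 'a set) \<Rightarrow> ('a ^ 'm) set" where
  "direct_sum V = {x. \<forall>i. x $ i \<in> V i}"

definition proper_on :: "'a set \<Rightarrow> ('a \<Rightarrow> ereal) \<Rightarrow> bool" where
  "proper_on S \<phi> \<longleftrightarrow> (\<forall>x\<in>S. \<phi> x \<noteq> -\<infinity>) \<and> (\<exists>x\<in>S. \<phi> x \<noteq> \<infinity>)"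

definition convex_ereal_on :: "'a::real_vector set \<Rightarrow> ('a \<Rightarrow> ereal) \<Rightarrow> bool" where
  "convex_ereal_on S \<phi> \<longleftrightarrow> convex S \<and>
     (\<forall>x\<in>S. \<forall>y\<in>S. \<forall>t\<in>{0<..<1}.
        \<phi> ((1 - t) *\<^sub>R x + t *\<^sub>R y) \<le> ereal (1 - t) * \<phi> x + ereal t * \<phi> y)"

definition lsc_on :: "'a::topological_space set \<Rightarrow> ('a \<Rightarrow> ereal) \<Rightarrow> bool" where
  "lsc_on S \<phi> \<longleftrightarrow> (\<forall>x\<in>S. \<phi> x \<le> Liminf (at x within S) \<phi>)"

definition argmin_set :: "('a \<Rightarrow> ereal) \<Rightarrow> 'a set \<Rightarrow> 'a set" where
  "argmin_set \<phi> S = {x. is_arg_min \<phi> (\<lambda>z. z \<in> S) x}"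

definition prox :: "'a::real_normed_vector set \<Rightarrow> ('a \<Rightarrow> ereal) \<Rightarrow> 'a \<Rightarrow> 'a" where
  "prox S \<phi> x = arg_min_on (\<lambda>z. \<phi> z + ereal (1 / 2 * (norm (x - z))\<^sup>2)) S"

definition block_select :: "('m::finite \<Rightarrow> bool) \<Rightarrow> 'a::real_vector ^ 'm \<Rightarrow> 'a ^ 'm" (infixr "\<odot>" 75)
  where "e \<odot> v = (\<chi> i. of_bool (e i) *\<^sub>R v $ i)"

definition wnorm :: "('m::finite \<Rightarrow> real) \<Rightarrow> 'a::real_normed_vector ^ 'm \<Rightarrow> real" where
  "wnorm w x = sqrt (\<Sum>i\<in>UNIV. w i * (norm (x $ i))\<^sup>2)"

definition wdist :: "('m::finite \<Rightarrow> real) \<Rightarrow> 'a::real_normed_vector ^ 'm \<Rightarrow> ('a ^ 'm) set \<Rightarrow> real" where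
  "wdist w x S = (INF z\<in>S. wnorm w (x - z))"

definition separable_sum :: "('m::finite \<Rightarrow> 'a \<Rightarrow> ereal) \<Rightarrow> 'a ^ 'm \<Rightarrow> ereal" where
  "separable_sum h x = (\<Sum>i\<in>UNIV. h i (x $ i))"

definition fb_step ::
  "('m::finite \<Rightarrow> 'a::real_normed_vector set) \<Rightarrow> ('m \<Rightarrow> 'a \<Rightarrow> ereal) \<Rightarrow> ('a ^ 'm \<Rightarrow> 'a ^ 'm)
    \<Rightarrow> ('m \<Rightarrow> real) \<Rightarrow> 'a ^ 'm \<Rightarrow> 'a ^ 'm" where
  "fb_step V h grad \<gamma> x =
     (\<chi> i. prox (V i) (\<lambda>z. ereal (\<gamma> i) * h i z) (x $ i - \<gamma> i *\<^sub>R grad x $ i))"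

definition ereal_expectation :: "'w measure \<Rightarrow> ('w \<Rightarrow> ereal) \<Rightarrow> ereal" where
  "ereal_expectation M Y =
     enn2ereal (\<integral>\<^sup>+ \<omega>. e2ennreal (Y \<omega>) \<partial>M) - enn2ereal (\<integral>\<^sup>+ \<omega>. e2ennreal (- Y \<omega>) \<partial>M)"

end

theory Submission
  imports Defs
begin

text \<open>
  Each iterate depends on finitely many of the \<open>\<epsilon>\<^sup>k\<close>, hence takes finitely many values; conditional
  expectations reduce to finite sums and the proximity operators need not be measurable.

  Let \<open>y\<close> be the forward-backward step of \<open>x\<close>, \<open>v = y - x\<close>, \<open>D = \<parallel>v\<parallel>\<close> in the \<open>\<Gamma>\<^sup>-\<^sup>1\<close>-norm,
  \<open>a = (2 - \<delta>) / 2\<close>, and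
  \<open>B\<^sub>i = h\<^sub>i(y\<^sub>i) - h\<^sub>i(x\<^sub>i) + \<langle>\<nabla>\<^sub>i f(x), v\<^sub>i\<rangle> + (\<nu>\<^sub>i / 2) \<parallel>v\<^sub>i\<parallel>\<^sup>2\<close>.
  Smoothness gives \<open>E F(x\<^sup>+) \<le> F(x) + \<Sum> p\<^sub>i B\<^sub>i\<close>. The variational inequality of the proximity
  operator, tested at \<open>x\<close>, shows that every \<open>B\<^sub>i\<close> is nonpositive and \<open>\<Sum> B\<^sub>i \<le> - a D\<^sup>2\<close>; tested at
  minimizers it gives \<open>\<Sum> B\<^sub>i \<le> F\<^sub>* - F(x) + D dist(x, S\<^sub>*) - a D\<^sup>2 \<le> F\<^sub>* - F(x) + (c - a) D\<^sup>2\<close>.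
  A convex combination of the two bounds eliminates \<open>D\<close> and yields the rate.

  For the iterates, \<open>E \<parallel>x\<^sup>+ - x\<parallel>\<^sup>2 = D\<^sup>2\<close> in the \<open>W\<close>-norm, and \<open>a p\<^sub>m\<^sub>i\<^sub>n D\<^sup>2 \<le> F(x) - E F(x\<^sup>+)\<close>, so the
  expected increments decay like \<open>rate\<^sup>n\<^sup>/\<^sup>2\<close> and are summable. Almost surely the
  sequence is therefore Cauchy, and its limit is a minimizer by lower semicontinuity of \<open>F\<close>.
\<close>

section \<open>Convex functions and proximity operators\<close>

text \<open>The filter in \<open>lsc_on\<close> is punctured at \<open>z\<close>; indices with
  \<open>u n = z\<close> are covered because the level \<open>y\<close> already lies below
  \<open>\<phi> z\<close>.\<close>

lemma lsc_on_liminf: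
  assumes "lsc_on S \<phi>" "z \<in> S" "\<And>n. u n \<in> S" "u \<longlonglongrightarrow> z"
  shows "\<phi> z \<le> liminf (\<lambda>n. \<phi> (u n))"
  unfolding le_Liminf_iff
proof safe
  fix y assume y: "y < \<phi> z"
  have "\<phi> z \<le> Liminf (at z within S) \<phi>"
    using assms by (simp add: lsc_on_def)
  with y have "eventually (\<lambda>x. y < \<phi> x) (at z within S)"
    unfolding le_Liminf_iff by simp
  then have ev: "eventually (\<lambda>x. x \<noteq> z \<longrightarrow> x \<in> S \<longrightarrow> y < \<phi> x) (nhds z)"
    by (simp add: eventually_at_filter)
  have "eventually (\<lambda>n. u n \<noteq> z \<longrightarrow> u n \<in> S \<longrightarrow> y < \<phi> (u n)) sequentially"
    using eventually_compose_filterlim[OF ev assms(4)] .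
  then show "eventually (\<lambda>n. y < \<phi> (u n)) sequentially"
    by eventually_elim (use y assms(3) in metis)
qed

text \<open>
  No separation theorem is needed: a lower bound for \<open>h\<close> near \<open>z0\<close> propagates linearly along rays
  by convexity.
\<close>

lemma convex_lsc_minorant:
  fixes V :: "'a::real_normed_vector set"
  assumes cvx: "convex_ereal_on V h" and lsc: "lsc_on V h"
    and z0: "z0 \<in> V" "h z0 = ereal b"
  obtains K where "K \<ge> 0" "\<And>z. z \<in> V \<Longrightarrow> ereal (b - 1 - K * norm (z - z0)) \<le> h z"
proof -
  have cV: "convex V" using cvx by (simp add: convex_ereal_on_def)
  have "h z0 \<le> Liminf (at z0 within V) h"
    using lsc z0(1) by (simp add: lsc_on_def)
  moreover have "ereal (b - 1) < h z0" using z0 by simp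
  ultimately have "eventually (\<lambda>z. ereal (b - 1) < h z) (at z0 within V)"
    unfolding le_Liminf_iff by blast
  then obtain d where d: "d > 0"
    "\<And>z. z \<in> V \<Longrightarrow> z \<noteq> z0 \<Longrightarrow> dist z z0 < d \<Longrightarrow> ereal (b - 1) < h z"
    by (auto simp: eventually_at)
  have near: "ereal (b - 1) < h z" if "z \<in> V" "norm (z - z0) < d" for z
    using d(2)[OF that(1)] that z0 by (cases "z = z0") (auto simp: dist_norm)
  show ?thesis
  proof (rule that[of "2 / d"])
    show "2 / d \<ge> 0" using d by simp
  next
    fix z assume z: "z \<in> V"
    define r where "r = norm (z - z0)"
    show "ereal (b - 1 - 2 / d * norm (z - z0)) \<le> h z"
    proof (cases "r < d")
      case True
      then have "ereal (b - 1) < h z" using near z r_def by blast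
      moreover have "ereal (b - 1 - 2 / d * norm (z - z0)) \<le> ereal (b - 1)" using d by simp
      ultimately show ?thesis by (meson less_imp_le order_trans)
    next
      case False
      \<comment> \<open>This puts \<open>w\<close> at distance \<open>d / 2\<close> from
        \<open>z0\<close>, inside the ball where \<open>h\<close> exceeds \<open>b - 1\<close>.
        Convexity along the segment then gives \<open>b - s < 1 / t\<close>, which is the source of
        the slope \<open>2 / d\<close>.\<close>
      define t where "t = d / (2 * r)"
      have rt: "r > 0" "0 < t" "t < 1" "1 / t = 2 / d * r"
        using False d by (auto simp: t_def field_simps)
      define w where "w = (1 - t) *\<^sub>R z0 + t *\<^sub>R z"
      have w: "w \<in> V"
        unfolding w_def using convexD[OF cV z0(1) z, of "1 - t" t] rt by simp
      have "w - z0 = t *\<^sub>R (z - z0)" by (simp add: w_def algebra_simps)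
      then have "norm (w - z0) = t * r" using rt by (simp add: r_def)
      also have "\<dots> < d" using rt d by (simp add: t_def)
      finally have lo: "ereal (b - 1) < h w" using near w by blast
      have hi: "h w \<le> ereal (1 - t) * h z0 + ereal t * h z"
        using cvx z0 z rt unfolding w_def convex_ereal_on_def by auto
      show ?thesis
      proof (cases "h z")
        case (real s)
        have "ereal (b - 1) < ereal ((1 - t) * b + t * s)"
          using less_le_trans[OF lo hi] real z0 by simp
        then have "t * (b - s) < 1" by (simp add: algebra_simps)
        then have "b - s < 1 / t" using rt by (simp add: field_simps)
        then show ?thesis using rt real by (simp add: r_def)
      next
        case PInf then show ?thesis by simp
      next
        case MInf
        then have "ereal (1 - t) * h z0 + ereal t * h z = -\<infinity>" using rt z0 by simp
        with less_le_trans[OF lo hi] show ?thesis by (simp del: ereal_plus_eq_MInfty)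
      qed
    qed
  qed
qed

lemma midpoint_parallelogram:
  fixes u z w :: "'a::real_inner"
  shows "(norm (u - (1 / 2) *\<^sub>R (z + w)))\<^sup>2 =
    1 / 2 * (norm (u - z))\<^sup>2 + 1 / 2 * (norm (u - w))\<^sup>2 - 1 / 4 * (norm (z - w))\<^sup>2"
  by (simp add: power2_norm_eq_inner inner_simps inner_commute field_simps)

text \<open>Properness excludes the value \<open>-\<infinity>\<close>, so the extended-real
  convexity inequality passes to real parts, where terms can be subtracted.\<close>

lemma convex_ereal_on_real:
  assumes "convex_ereal_on V h" "proper_on V h" "z \<in> V" "w \<in> V" "h z \<noteq> \<infinity>" "h w \<noteq> \<infinity>" "0 < t" "t < 1"
  shows "(1 - t) *\<^sub>R z + t *\<^sub>R w \<in> V" "h ((1 - t) *\<^sub>R z + t *\<^sub>R w) \<noteq> \<infinity>"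
    "real_of_ereal (h ((1 - t) *\<^sub>R z + t *\<^sub>R w))
      \<le> (1 - t) * real_of_ereal (h z) + t * real_of_ereal (h w)"
proof -
  let ?m = "(1 - t) *\<^sub>R z + t *\<^sub>R w"
  show m: "?m \<in> V"
    using assms convexD[of V z w "1 - t" t] by (simp add: convex_ereal_on_def)
  have ni: "h z \<noteq> -\<infinity>" "h w \<noteq> -\<infinity>" "h ?m \<noteq> -\<infinity>"
    using assms m by (auto simp: proper_on_def)
  have le: "h ?m \<le> ereal (1 - t) * h z + ereal t * h w"
    using assms unfolding convex_ereal_on_def by auto
  obtain a b where ab: "h z = ereal a" "h w = ereal b"
    using ni assms by (metis ereal_cases)
  have le2: "h ?m \<le> ereal ((1 - t) * a + t * b)" using le ab by simp
  then show "h ?m \<noteq> \<infinity>" by auto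
  then obtain e where "h ?m = ereal e" using ni by (metis ereal_cases)
  with le2 ab show "real_of_ereal (h ?m)
      \<le> (1 - t) * real_of_ereal (h z) + t * real_of_ereal (h w)" by simp
qed

text \<open>Direct method: the lower bound on \<open>h\<close>, linear in the distance, is absorbed
  by the quadratic; the parallelogram identity makes a minimizing sequence Cauchy; completeness and
  lower semicontinuity then yield the minimizer.\<close>

lemma prox_minimizer_exists:
  fixes V :: "'a::{real_inner, banach} set"
  assumes V: "closed V" and pr: "proper_on V h" and cvx: "convex_ereal_on V h" and lsc: "lsc_on V h"
    and g: "\<gamma> > 0"
  shows "\<exists>y. is_arg_min (\<lambda>z. ereal \<gamma> * h z + ereal (1 / 2 * (norm (u - z))\<^sup>2)) (\<lambda>z. z \<in> V) y"
proof -
  define D where "D = {z \<in> V. h z \<noteq> \<infinity>}"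
  define hr where "hr z = real_of_ereal (h z)" for z
  define \<phi> where "\<phi> z = \<gamma> * hr z + 1 / 2 * (norm (u - z))\<^sup>2" for z
  have hD: "h z = ereal (hr z)" if "z \<in> D" for z
    using that pr by (auto simp: D_def hr_def proper_on_def ereal_real)
  obtain z0 where z0: "z0 \<in> D" using pr by (auto simp: proper_on_def D_def)
  obtain K where K: "K \<ge> 0" "\<And>z. z \<in> V \<Longrightarrow> ereal (hr z0 - 1 - K * norm (z - z0)) \<le> h z"
    using convex_lsc_minorant[OF cvx lsc, of z0 "hr z0"] hD[OF z0] z0 by (auto simp: D_def)
  \<comment> \<open>Completing the square: \<open>\<gamma> * K * r - r\<^sup>2 / 2\<close> never
    exceeds \<open>(\<gamma> * K)\<^sup>2 / 2\<close>, where \<open>r\<close> is the distance from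
    \<open>u\<close> to \<open>z\<close>.\<close>
  have low: "\<gamma> * (hr z0 - 1 - K * norm (u - z0)) - (\<gamma> * K)\<^sup>2 / 2 \<le> \<phi> z" if z: "z \<in> D" for z
  proof -
    have "hr z0 - 1 - K * norm (z - z0) \<le> hr z"
      using K(2)[of z] hD[OF z] z by (simp add: D_def)
    moreover have "K * norm (z - z0) \<le> K * (norm (u - z) + norm (u - z0))"
      using K(1) norm_triangle_ineq4[of "u - z0" "u - z"]
      by (intro mult_left_mono) (auto simp: algebra_simps)
    ultimately have "hr z0 - 1 - K * norm (u - z0) - K * norm (u - z) \<le> hr z"
      by (simp add: algebra_simps)
    then have "\<gamma> * (hr z0 - 1 - K * norm (u - z0) - K * norm (u - z)) \<le> \<gamma> * hr z"
      using g by (intro mult_left_mono) auto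
    moreover have "0 \<le> (\<gamma> * K - norm (u - z))\<^sup>2" by simp
    ultimately show ?thesis
      by (simp add: \<phi>_def power2_eq_square algebra_simps)
  qed
  define m where "m = Inf (\<phi> ` D)"
  have bdd: "bdd_below (\<phi> ` D)" using low by (auto intro!: bdd_belowI)
  have m_le: "m \<le> \<phi> z" if "z \<in> D" for z
    unfolding m_def using that bdd by (simp add: cINF_lower)
  have "\<exists>z\<in>D. \<phi> z < m + 1 / real (Suc n)" for n
  proof -
    have "m < m + 1 / real (Suc n)" by simp
    then show ?thesis
      unfolding m_def using z0 bdd by (subst (asm) cINF_less_iff) auto
  qed
  then obtain s where s: "\<And>n. s n \<in> D" "\<And>n. \<phi> (s n) < m + 1 / real (Suc n)"
    by metis
  \<comment> \<open>The value at the midpoint is at least \<open>m\<close>, while strong convexity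
    puts it below the average by an eighth of the squared distance.\<close>
  have close: "(norm (z - w))\<^sup>2 \<le> 4 * (\<phi> z - m) + 4 * (\<phi> w - m)" if zw: "z \<in> D" "w \<in> D" for z w
  proof -
    have mid: "(1 - 1 / 2) *\<^sub>R z + (1 / 2) *\<^sub>R w = (1 / 2) *\<^sub>R (z + w)"
      by (simp add: scaleR_right_distrib)
    have c: "(1 / 2) *\<^sub>R (z + w) \<in> D" "hr ((1 / 2) *\<^sub>R (z + w)) \<le> 1 / 2 * hr z + 1 / 2 * hr w"
      using convex_ereal_on_real[OF cvx pr, of z w "1 / 2"] zw mid by (auto simp: D_def hr_def)
    have "\<gamma> * hr ((1 / 2) *\<^sub>R (z + w)) \<le> \<gamma> * (1 / 2 * hr z + 1 / 2 * hr w)"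
      using c g by (intro mult_left_mono) auto
    then have "\<phi> ((1 / 2) *\<^sub>R (z + w)) \<le> 1 / 2 * \<phi> z + 1 / 2 * \<phi> w - 1 / 8 * (norm (z - w))\<^sup>2"
      unfolding \<phi>_def midpoint_parallelogram by (simp add: algebra_simps)
    with m_le[OF c(1)] show ?thesis by simp
  qed
  have "Cauchy s"
  proof (rule metric_CauchyI)
    fix e :: real assume e: "e > 0"
    \<comment> \<open>Both gaps to \<open>m\<close> are then below \<open>e\<^sup>2 / 8\<close>, and
      the factor 4 on each gives \<open>e\<^sup>2\<close> in total.\<close>
    obtain N :: nat where N: "8 / e\<^sup>2 < real N" using reals_Archimedean2 by blast
    show "\<exists>M. \<forall>m\<ge>M. \<forall>n\<ge>M. dist (s m) (s n) < e"
    proof (intro exI[of _ N] allI impI)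
      fix k l assume kl: "N \<le> k" "N \<le> l"
      have b: "1 / real (Suc j) < e\<^sup>2 / 8" if "N \<le> j" for j
      proof -
        have "8 / e\<^sup>2 < real (Suc j)" using N that by linarith
        then show ?thesis using e by (simp add: field_simps)
      qed
      have "(norm (s k - s l))\<^sup>2 < e\<^sup>2"
        using close[OF s(1) s(1), of k l] less_trans[OF s(2) add_strict_left_mono[OF b[OF kl(1)]]]
          less_trans[OF s(2) add_strict_left_mono[OF b[OF kl(2)]]] by (simp add: algebra_simps)
      then show "dist (s k) (s l) < e"
        using e by (simp add: dist_norm power2_less_imp_less)
    qed
  qed
  then obtain y where y: "s \<longlonglongrightarrow> y" by (auto simp: Cauchy_convergent_iff convergent_def)
  have yV: "y \<in> V"
    using closed_sequentially[OF V _ y] s by (auto simp: D_def)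
  \<comment> \<open>Solving near-minimality for \<open>h\<close> leaves a right-hand side that has a
    limit, so lower semicontinuity of \<open>h\<close> suffices to pass to \<open>y\<close>.\<close>
  have hs: "h (s n) \<le> ereal ((m + 1 / real (Suc n) - 1 / 2 * (norm (u - s n))\<^sup>2) / \<gamma>)" for n
  proof -
    have "hr (s n) * \<gamma> \<le> m + 1 / real (Suc n) - 1 / 2 * (norm (u - s n))\<^sup>2"
      using s(2)[of n] by (simp add: \<phi>_def mult.commute)
    then show ?thesis unfolding hD[OF s(1)] using g by (simp add: pos_le_divide_eq)
  qed
  have "(\<lambda>n. (m + 1 / real (Suc n) - 1 / 2 * (norm (u - s n))\<^sup>2) / \<gamma>)
      \<longlonglongrightarrow> (m + 0 - 1 / 2 * (norm (u - y))\<^sup>2) / \<gamma>"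
    by (intro tendsto_intros y LIMSEQ_Suc[OF lim_inverse_n'] g[THEN less_imp_neq, symmetric])
      (use g in auto)
  then have "(\<lambda>n. ereal ((m + 1 / real (Suc n) - 1 / 2 * (norm (u - s n))\<^sup>2) / \<gamma>))
      \<longlonglongrightarrow> ereal ((m - 1 / 2 * (norm (u - y))\<^sup>2) / \<gamma>)"
    by simp
  then have "liminf (\<lambda>n. ereal ((m + 1 / real (Suc n) - 1 / 2 * (norm (u - s n))\<^sup>2) / \<gamma>))
      = ereal ((m - 1 / 2 * (norm (u - y))\<^sup>2) / \<gamma>)"
    by (rule lim_imp_Liminf[rotated]) simp
  moreover have "h y \<le> liminf (\<lambda>n. h (s n))"
    using lsc_on_liminf[OF lsc yV _ y] s by (auto simp: D_def)
  moreover have "liminf (\<lambda>n. h (s n))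
      \<le> liminf (\<lambda>n. ereal ((m + 1 / real (Suc n) - 1 / 2 * (norm (u - s n))\<^sup>2) / \<gamma>))"
    using hs by (intro Liminf_mono) auto
  ultimately have hy: "h y \<le> ereal ((m - 1 / 2 * (norm (u - y))\<^sup>2) / \<gamma>)"
    by (metis order_trans)
  have yD: "y \<in> D" using hy yV by (auto simp: D_def)
  have "\<phi> y \<le> m" using hy hD[OF yD] g by (simp add: \<phi>_def field_simps)
  have eq: "ereal \<gamma> * h z + ereal (1 / 2 * (norm (u - z))\<^sup>2) = ereal (\<phi> z)" if "z \<in> D" for z
    using hD[OF that] by (simp add: \<phi>_def)
  have infty: "ereal \<gamma> * h z + ereal (1 / 2 * (norm (u - z))\<^sup>2) = \<infinity>" if "z \<in> V" "z \<notin> D" for z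
    using that g by (simp add: D_def)
  have "\<not> ereal \<gamma> * h z + ereal (1 / 2 * (norm (u - z))\<^sup>2)
      < ereal \<gamma> * h y + ereal (1 / 2 * (norm (u - y))\<^sup>2)" if z: "z \<in> V" for z
  proof (cases "z \<in> D")
    case True
    then show ?thesis using eq[OF True] eq[OF yD] m_le[OF True] \<open>\<phi> y \<le> m\<close> by simp
  next
    case False
    then show ?thesis unfolding infty[OF z False] by simp
  qed
  then show ?thesis unfolding is_arg_min_def using yV by blast
qed

text \<open>\<open>prox\<close> is a choice among minimizers, and existence makes the chosen point a
  genuine one. Comparing it with points on the segment towards \<open>z\<close> and letting the step
  length tend to 0 gives the first-order inequality.\<close>

lemma prox_variational_inequality:
  fixes V :: "'a::{real_inner, banach} set" and u :: 'a and h :: "'a \<Rightarrow> ereal" and \<gamma> :: real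
  assumes V: "closed V" and pr: "proper_on V h" and cvx: "convex_ereal_on V h" and lsc: "lsc_on V h"
    and g: "\<gamma> > 0"
  defines "y \<equiv> prox V (\<lambda>z. ereal \<gamma> * h z) u"
  shows "y \<in> V" "h y \<noteq> \<infinity>"
    "\<And>z. z \<in> V \<Longrightarrow> h z \<noteq> \<infinity> \<Longrightarrow>
      \<gamma> * real_of_ereal (h y) + inner (u - y) (z - y) \<le> \<gamma> * real_of_ereal (h z)"
proof -
  let ?\<phi> = "\<lambda>z. ereal \<gamma> * h z + ereal (1 / 2 * (norm (u - z))\<^sup>2)"
  have am: "is_arg_min ?\<phi> (\<lambda>z. z \<in> V) y"
    unfolding y_def prox_def arg_min_on_def arg_min_def
    by (rule someI_ex[OF prox_minimizer_exists[OF V pr cvx lsc g]])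
  then show yV: "y \<in> V" by (simp add: is_arg_min_def)
  have le: "?\<phi> y \<le> ?\<phi> z" if "z \<in> V" for z
    using am that by (auto simp: is_arg_min_def not_less)
  obtain z0 where "z0 \<in> V" "h z0 \<noteq> \<infinity>" using pr by (auto simp: proper_on_def)
  moreover from this have "h z0 \<noteq> -\<infinity>" using pr by (auto simp: proper_on_def)
  ultimately obtain b where z0: "z0 \<in> V" "h z0 = ereal b" by (metis ereal_cases)
  show hy: "h y \<noteq> \<infinity>"
    using le[OF z0(1)] z0 g by auto
  fix z assume z: "z \<in> V" "h z \<noteq> \<infinity>"
  define hr where "hr w = real_of_ereal (h w)" for w
  have fin: "h w = ereal (hr w)" if "w \<in> V" "h w \<noteq> \<infinity>" for w
    using that pr by (auto simp: hr_def proper_on_def ereal_real)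
  \<comment> \<open>Minimality against \<open>?m\<close>, with a common factor \<open>t\<close>
    divided out; only the quadratic remainder still carries \<open>t\<close>.\<close>
  have key: "\<gamma> * hr y + inner (u - y) (z - y) - t / 2 * (norm (z - y))\<^sup>2 \<le> \<gamma> * hr z"
    if t: "0 < t" "t < 1" for t
  proof -
    let ?m = "(1 - t) *\<^sub>R y + t *\<^sub>R z"
    note m = convex_ereal_on_real[OF cvx pr yV z(1) hy z(2) t]
    have um: "u - ?m = (u - y) - t *\<^sub>R (z - y)" by (simp add: algebra_simps)
    have nm: "(norm (u - ?m))\<^sup>2 = (norm (u - y))\<^sup>2 - 2 * t * inner (u - y) (z - y) + t\<^sup>2 * (norm (z - y))\<^sup>2"
      unfolding um power2_norm_eq_inner
      by (simp add: inner_diff_left inner_diff_right inner_commute power2_eq_square algebra_simps)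
    have "\<gamma> * hr y + 1 / 2 * (norm (u - y))\<^sup>2 \<le> \<gamma> * hr ?m + 1 / 2 * (norm (u - ?m))\<^sup>2"
      using le[OF m(1)] fin[OF m(1,2)] fin[OF yV hy] by simp
    also have "\<gamma> * hr ?m \<le> \<gamma> * ((1 - t) * hr y + t * hr z)"
      using m(3) g by (intro mult_left_mono) (auto simp: hr_def)
    finally have "0 \<le> t * (\<gamma> * hr z - (\<gamma> * hr y + inner (u - y) (z - y) - t / 2 * (norm (z - y))\<^sup>2))"
      unfolding nm by (simp add: algebra_simps power2_eq_square)
    then show ?thesis using t by (simp add: zero_le_mult_iff)
  qed
  have "((\<lambda>t. \<gamma> * hr y + inner (u - y) (z - y) - t / 2 * (norm (z - y))\<^sup>2)
      \<longlongrightarrow> \<gamma> * hr y + inner (u - y) (z - y) - 0 / 2 * (norm (z - y))\<^sup>2) (at_right 0)"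
    by (intro tendsto_intros) auto
  moreover have "eventually (\<lambda>t. \<gamma> * hr y + inner (u - y) (z - y) - t / 2 * (norm (z - y))\<^sup>2 \<le> \<gamma> * hr z)
      (at_right 0)"
    using key by (auto simp: eventually_at_right_field intro!: exI[of _ 1])
  ultimately have "\<gamma> * hr y + inner (u - y) (z - y) - 0 / 2 * (norm (z - y))\<^sup>2 \<le> \<gamma> * hr z"
    by (intro tendsto_upperbound) auto
  then show "\<gamma> * real_of_ereal (h y) + inner (u - y) (z - y) \<le> \<gamma> * real_of_ereal (h z)"
    by (simp add: hr_def)
qed

text \<open>Reduces to the tangent inequality in one variable. The whole line through
  \<open>y\<close> and \<open>z\<close> stays in the subspace \<open>H\<close>, so the derivative
  relative to \<open>H\<close> becomes a full derivative along the line.\<close>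

lemma convex_gradient_inequality:
  fixes f :: "'a::real_inner \<Rightarrow> real"
  assumes H: "subspace H" and cvx: "convex_on H f" and y: "y \<in> H" and z: "z \<in> H"
    and der: "(f has_derivative (\<lambda>v. inner g v)) (at y within H)"
  shows "f y + inner g (z - y) \<le> f z"
proof -
  define l where "l t = y + t *\<^sub>R (z - y)" for t :: real
  have lH: "l t \<in> H" for t
    unfolding l_def using H y z by (intro subspace_add subspace_scale subspace_diff)
  have "convex_on UNIV (\<lambda>t. f (l t))"
  proof (rule convex_onI)
    fix t s1 s2 :: real assume t: "0 < t" "t < 1"
    have "l ((1 - t) *\<^sub>R s1 + t *\<^sub>R s2) = (1 - t) *\<^sub>R l s1 + t *\<^sub>R l s2"
      by (simp add: l_def algebra_simps)
    then show "f (l ((1 - t) *\<^sub>R s1 + t *\<^sub>R s2)) \<le> (1 - t) * f (l s1) + t * f (l s2)"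
      using convex_onD[OF cvx, of t "l s1" "l s2"] t lH by simp
  qed auto
  moreover have "((\<lambda>t. f (l t)) has_real_derivative inner g (z - y)) (at 0 within UNIV)"
  proof -
    have "(l has_derivative (\<lambda>t. t *\<^sub>R (z - y))) (at 0)"
      unfolding l_def by (auto intro!: derivative_eq_intros)
    moreover have "(f has_derivative (\<lambda>v. inner g v)) (at (l 0) within H)"
      using der by (simp add: l_def)
    then have "(f has_derivative (\<lambda>v. inner g v)) (at (l 0) within range l)"
      by (rule has_derivative_subset) (use lH in auto)
    ultimately have "((\<lambda>t. f (l t)) has_derivative (\<lambda>t. inner g (t *\<^sub>R (z - y)))) (at 0)"
      by (rule has_derivative_in_compose)
    then show ?thesis
      by (simp add: has_field_derivative_def mult_commute_abs)
  qed
  ultimately have "f (l 1) - f (l 0) \<ge> inner g (z - y) * (1 - 0)"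
    by (intro convex_on_imp_above_tangent[where A = UNIV]) auto
  then show ?thesis by (simp add: l_def)
qed

text \<open>Superadditivity of the lower limit must avoid \<open>\<infinity> - \<infinity>\<close>.
  Properness at the limit point and the inductive bound keep both lower limits away from
  \<open>-\<infinity>\<close>.\<close>

lemma sum_lsc_on_liminf:
  fixes h :: "'m \<Rightarrow> 'a::topological_space \<Rightarrow> ereal"
  assumes "finite A" "\<And>i. i \<in> A \<Longrightarrow> lsc_on (V i) (h i)" "\<And>i. i \<in> A \<Longrightarrow> proper_on (V i) (h i)"
    and "\<And>i. i \<in> A \<Longrightarrow> z i \<in> V i" "\<And>i n. i \<in> A \<Longrightarrow> u n i \<in> V i"
    and "\<And>i. i \<in> A \<Longrightarrow> (\<lambda>n. u n i) \<longlonglongrightarrow> z i"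
  shows "(\<Sum>i\<in>A. h i (z i)) \<le> liminf (\<lambda>n. \<Sum>i\<in>A. h i (u n i))"
  using assms
proof (induction A rule: finite_induct)
  case empty
  then show ?case by (simp add: Liminf_const)
next
  case (insert j A)
  have IH: "(\<Sum>i\<in>A. h i (z i)) \<le> liminf (\<lambda>n. \<Sum>i\<in>A. h i (u n i))"
    using insert by auto
  have j: "h j (z j) \<le> liminf (\<lambda>n. h j (u n j))"
    using insert.prems by (intro lsc_on_liminf[of "V j"]) auto
  have ni: "h i (z i) \<noteq> -\<infinity>" if "i \<in> insert j A" for i
    using insert.prems(2)[OF that] insert.prems(3)[OF that] by (auto simp: proper_on_def)
  have "(\<Sum>i\<in>A. h i (z i)) \<noteq> -\<infinity>"
    using \<open>finite A\<close> ni by (induction A rule: finite_induct) auto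
  then have "liminf (\<lambda>n. \<Sum>i\<in>A. h i (u n i)) \<noteq> -\<infinity>" "liminf (\<lambda>n. h j (u n j)) \<noteq> -\<infinity>"
    using IH j ni[of j] by auto
  then have "liminf (\<lambda>n. h j (u n j)) + liminf (\<lambda>n. \<Sum>i\<in>A. h i (u n i))
      \<le> liminf (\<lambda>n. h j (u n j) + (\<Sum>i\<in>A. h i (u n i)))"
    by (intro ereal_liminf_add_mono) auto
  with IH j have "h j (z j) + (\<Sum>i\<in>A. h i (z i)) \<le> liminf (\<lambda>n. h j (u n j) + (\<Sum>i\<in>A. h i (u n i)))"
    by (meson add_mono order_trans)
  then show ?case using insert.hyps by simp
qed

section \<open>Summable increments and weighted norms\<close>

text \<open>The increments telescope. The tail bound is kept along with convergence because it turns
  a rate for the increments into a rate for the distance to the limit.\<close>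

lemma summable_increments_convergent:
  fixes u :: "nat \<Rightarrow> 'a::banach"
  assumes sm: "summable (\<lambda>n. norm (u (Suc n) - u n))"
  obtains l where "u \<longlonglongrightarrow> l"
    "\<And>n. norm (u n - l) \<le> (\<Sum>k. norm (u (Suc (k + n)) - u (k + n)))"
proof -
  have "summable (\<lambda>n. u (Suc n) - u n)" using sm by (rule summable_norm_cancel)
  then have "(\<lambda>n. \<Sum>k<n. u (Suc k) - u k) \<longlonglongrightarrow> (\<Sum>n. u (Suc n) - u n)"
    by (rule summable_LIMSEQ)
  then have "(\<lambda>n. (u n - u 0) + u 0) \<longlonglongrightarrow> (\<Sum>n. u (Suc n) - u n) + u 0"
    by (intro tendsto_add) (auto simp: sum_lessThan_telescope)
  then obtain l where l: "u \<longlonglongrightarrow> l" by auto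
  have "norm (u n - l) \<le> (\<Sum>k. norm (u (Suc (k + n)) - u (k + n)))" for n
  proof -
    have "(\<lambda>k. u (Suc k + n) - u (k + n)) sums (l - u (0 + n))"
      using LIMSEQ_ignore_initial_segment[OF l, of n] by (rule telescope_sums)
    then have "l - u n = (\<Sum>k. u (Suc (k + n)) - u (k + n))" by (simp add: sums_iff)
    moreover have "summable (\<lambda>k. norm (u (Suc (k + n)) - u (k + n)))"
      using summable_ignore_initial_segment[OF sm, of n] by simp
    ultimately show ?thesis using summable_norm by (metis norm_minus_commute)
  qed
  with l that show ?thesis by blast
qed

text \<open>Turns \<open>wnorm\<close> with nonnegative weights into the ordinary norm, so that the
  Cauchy-Schwarz inequality and completeness carry over.\<close>

definition block_scale :: "('m::finite \<Rightarrow> real) \<Rightarrow> 'a::real_vector ^ 'm \<Rightarrow> 'a ^ 'm" where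
  "block_scale w z = (\<chi> i. sqrt (w i) *\<^sub>R z $ i)"

lemma block_scale_diff: "block_scale w (y - z) = block_scale w y - block_scale w z"
  by (simp add: block_scale_def vec_eq_iff algebra_simps)

lemma wnorm_eq_norm: "(\<And>i. 0 \<le> w i) \<Longrightarrow> wnorm w z = norm (block_scale w z)"
  by (simp add: wnorm_def norm_vec_def L2_set_def block_scale_def power_mult_distrib)

lemma wnorm_nonneg: "(\<And>i. 0 \<le> w i) \<Longrightarrow> 0 \<le> wnorm w z"
  by (simp add: wnorm_eq_norm)

lemma wnorm_power2: "(\<And>i. 0 \<le> w i) \<Longrightarrow> (wnorm w z)\<^sup>2 = (\<Sum>i\<in>UNIV. w i * (norm (z $ i))\<^sup>2)"
  by (simp add: wnorm_def sum_nonneg)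

lemma wnorm_Cauchy_Schwarz:
  fixes y z :: "'a::real_inner ^ 'm::finite"
  assumes "\<And>i. 0 \<le> w i"
  shows "(\<Sum>i\<in>UNIV. w i * inner (y $ i) (z $ i)) \<le> wnorm w y * wnorm w z"
proof -
  have "(\<Sum>i\<in>UNIV. w i * inner (y $ i) (z $ i)) = inner (block_scale w y) (block_scale w z)"
    using assms by (simp add: inner_vec_def block_scale_def mult.assoc[symmetric])
  also have "\<dots> \<le> wnorm w y * wnorm w z"
    using assms by (simp add: wnorm_eq_norm norm_cauchy_schwarz)
  finally show ?thesis .
qed

lemma tendsto_block_scale_cancel:
  fixes u :: "nat \<Rightarrow> 'a::real_normed_vector ^ 'm::finite"
  assumes "(\<lambda>n. block_scale w (u n)) \<longlonglongrightarrow> l" "\<And>i. 0 < w i"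
  shows "\<exists>z. u \<longlonglongrightarrow> z \<and> block_scale w z = l"
proof (intro exI conjI)
  have sw: "sqrt (w i) \<noteq> 0" for i using assms(2)[of i] by simp
  show "u \<longlonglongrightarrow> (\<chi> i. (1 / sqrt (w i)) *\<^sub>R l $ i)"
  proof (rule vec_tendstoI)
    fix i
    have "(\<lambda>n. (1 / sqrt (w i)) *\<^sub>R block_scale w (u n) $ i) \<longlonglongrightarrow> (1 / sqrt (w i)) *\<^sub>R l $ i"
      by (intro tendsto_intros assms)
    then show "(\<lambda>n. u n $ i) \<longlonglongrightarrow> (\<chi> i. (1 / sqrt (w i)) *\<^sub>R l $ i) $ i"
      using sw by (simp add: block_scale_def)
  qed
  show "block_scale w (\<chi> i. (1 / sqrt (w i)) *\<^sub>R l $ i) = l"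
    using sw by (simp add: block_scale_def vec_eq_iff)
qed

section \<open>Random variables with finitely many values\<close>

lemma integral_of_bool:
  "(\<integral>\<omega>. (of_bool (\<epsilon> \<omega> i) :: real) \<partial>M) = measure M {\<omega> \<in> space M. \<epsilon> \<omega> i}"
proof -
  have "(\<integral>\<omega>. (of_bool (\<epsilon> \<omega> i) :: real) \<partial>M) = (\<integral>\<omega>. indicator {\<omega> \<in> space M. \<epsilon> \<omega> i} \<omega> \<partial>M)"
    by (intro Bochner_Integration.integral_cong) (auto simp: indicator_def)
  moreover have "{\<omega> \<in> space M. \<epsilon> \<omega> i} \<inter> space M = {\<omega> \<in> space M. \<epsilon> \<omega> i}" by auto
  ultimately show ?thesis by simp
qed

text \<open>The target carries the discrete sigma-algebra of the product type, which can be larger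
  than the product of the two discrete ones. Splitting over the finitely many values of
  \<open>Z\<close> still gives measurability.\<close>

lemma measurable_pair_finite:
  fixes Z :: "'w \<Rightarrow> 'e::finite"
  assumes "Y \<in> measurable M (count_space UNIV)" "Z \<in> measurable M (count_space UNIV)"
  shows "(\<lambda>\<omega>. (Y \<omega>, Z \<omega>)) \<in> measurable M (count_space UNIV)"
proof (rule measurable_compose_countable'[where I = UNIV and f = "\<lambda>e \<omega>. (Y \<omega>, e)" and g = Z])
  show "(\<lambda>\<omega>. (Y \<omega>, i)) \<in> measurable M (count_space UNIV)" for i
    using measurable_compose[OF assms(1), of "\<lambda>y. (y, i)"] by simp
qed (use assms in \<open>auto intro: countable_finite\<close>)

context prob_space
begin

text \<open>With finitely many values, \<open>g (Y \<omega>)\<close> is a linear combination of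
  indicators whatever \<open>g\<close> is. This is how functions built from the proximity operators
  get expectations.\<close>

lemma
  fixes g :: "'b \<Rightarrow> real"
  assumes Y: "Y \<in> measurable M (count_space UNIV)" and A: "finite A" "Y ` space M \<subseteq> A"
  shows integrable_finite_range: "integrable M (\<lambda>\<omega>. g (Y \<omega>))"
    and expectation_finite_range:
      "expectation (\<lambda>\<omega>. g (Y \<omega>)) = (\<Sum>a\<in>A. g a * prob (Y -` {a} \<inter> space M))"
proof -
  have eq: "g (Y \<omega>) = (\<Sum>a\<in>A. g a * indicator (Y -` {a} \<inter> space M) \<omega>)" if "\<omega> \<in> space M" for \<omega>
  proof -
    have "(\<Sum>a\<in>A. g a * indicator (Y -` {a} \<inter> space M) \<omega>) = (\<Sum>a\<in>A. if a = Y \<omega> then g a else 0)"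
      using that by (intro sum.cong) (auto simp: indicator_def)
    then show ?thesis using A that by (auto simp: sum.delta)
  qed
  have [measurable]: "Y -` {a} \<inter> space M \<in> sets M" for a
    using Y by (rule measurable_sets) simp
  have int: "integrable M (\<lambda>\<omega>. g a * indicator (Y -` {a} \<inter> space M) \<omega>)" for a
    by (intro integrable_mult_right integrable_real_indicator) (auto simp: emeasure_eq_measure)
  have "integrable M (\<lambda>\<omega>. \<Sum>a\<in>A. g a * indicator (Y -` {a} \<inter> space M) \<omega>)"
    using int by (intro Bochner_Integration.integrable_sum) auto
  then show "integrable M (\<lambda>\<omega>. g (Y \<omega>))"
    by (subst Bochner_Integration.integrable_cong[OF refl eq])
  have "expectation (\<lambda>\<omega>. g (Y \<omega>))
      = expectation (\<lambda>\<omega>. \<Sum>a\<in>A. g a * indicator (Y -` {a} \<inter> space M) \<omega>)"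
    by (rule Bochner_Integration.integral_cong[OF refl eq])
  also have "\<dots> = (\<Sum>a\<in>A. g a * prob (Y -` {a} \<inter> space M))"
    using int by (subst Bochner_Integration.integral_sum) (auto intro!: sum.cong)
  finally show "expectation (\<lambda>\<omega>. g (Y \<omega>)) = (\<Sum>a\<in>A. g a * prob (Y -` {a} \<inter> space M))" .
qed

lemma integrable_finite_rv:
  fixes g :: "'e::finite \<Rightarrow> real"
  assumes "\<epsilon> \<in> measurable M (count_space UNIV)"
  shows "integrable M (\<lambda>\<omega>. g (\<epsilon> \<omega>))"
  by (rule integrable_finite_range[OF assms, of UNIV]) auto

text \<open>Integrating out \<open>Z\<close> with \<open>Y\<close> frozen is conditioning on
  \<open>Y\<close>. For finitely many values it is a rearranged finite sum, and independence is
  required on atoms only.\<close>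

lemma expectation_indep_finite:
  fixes \<phi> :: "'b \<Rightarrow> 'e::finite \<Rightarrow> real"
  assumes Y: "Y \<in> measurable M (count_space UNIV)" and Z: "Z \<in> measurable M (count_space UNIV)"
    and ind: "\<And>a e. prob ((\<lambda>\<omega>. (Y \<omega>, Z \<omega>)) -` {(a, e)} \<inter> space M)
      = prob (Y -` {a} \<inter> space M) * prob (Z -` {e} \<inter> space M)"
    and fin: "finite (Y ` space M)"
  shows "expectation (\<lambda>\<omega>. \<phi> (Y \<omega>) (Z \<omega>)) = expectation (\<lambda>\<omega>. expectation (\<lambda>\<omega>'. \<phi> (Y \<omega>) (Z \<omega>')))"
proof -
  let ?A = "Y ` space M"
  have "expectation (\<lambda>\<omega>. \<phi> (Y \<omega>) (Z \<omega>)) = expectation (\<lambda>\<omega>. case_prod \<phi> (Y \<omega>, Z \<omega>))"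
    by simp
  also have "\<dots> = (\<Sum>b\<in>?A \<times> UNIV. case_prod \<phi> b * prob ((\<lambda>\<omega>. (Y \<omega>, Z \<omega>)) -` {b} \<inter> space M))"
    using fin by (intro expectation_finite_range measurable_pair_finite Y Z) auto
  also have "\<dots> = (\<Sum>b\<in>?A \<times> UNIV. case_prod \<phi> b *
      (prob (Y -` {fst b} \<inter> space M) * prob (Z -` {snd b} \<inter> space M)))"
    by (intro sum.cong refl) (auto simp: ind)
  also have "\<dots> = (\<Sum>a\<in>?A. (\<Sum>e\<in>UNIV. \<phi> a e * prob (Z -` {e} \<inter> space M)) * prob (Y -` {a} \<inter> space M))"
    unfolding sum_distrib_right sum.cartesian_product by (intro sum.cong) auto
  also have "\<dots> = (\<Sum>a\<in>?A. expectation (\<lambda>\<omega>'. \<phi> a (Z \<omega>')) * prob (Y -` {a} \<inter> space M))"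
    by (intro sum.cong refl arg_cong2[where f = "(*)"] expectation_finite_range[symmetric] Z) auto
  also have "\<dots> = expectation (\<lambda>\<omega>. expectation (\<lambda>\<omega>'. \<phi> (Y \<omega>) (Z \<omega>')))"
    using fin by (intro expectation_finite_range[symmetric, where g = "\<lambda>a. expectation (\<lambda>\<omega>'. \<phi> a (Z \<omega>'))"] Y) auto
  finally show ?thesis .
qed

text \<open>Exchanging sum and integral makes the integral of the series finite, hence the series is
  finite almost everywhere.\<close>

lemma
  fixes d :: "nat \<Rightarrow> 'a \<Rightarrow> real"
  assumes int: "\<And>n. integrable M (d n)" and nn: "\<And>n \<omega>. \<omega> \<in> space M \<Longrightarrow> 0 \<le> d n \<omega>"
    and sm: "summable (\<lambda>n. expectation (d n))"
  shows AE_summable: "AE \<omega> in M. summable (\<lambda>n. d n \<omega>)"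
    and nn_integral_suminf_real: "(\<integral>\<^sup>+\<omega>. (\<Sum>n. ennreal (d n \<omega>)) \<partial>M) = ennreal (\<Sum>n. expectation (d n))"
proof -
  have [measurable]: "d n \<in> borel_measurable M" for n using int by auto
  have "(\<integral>\<^sup>+\<omega>. (\<Sum>n. ennreal (d n \<omega>)) \<partial>M) = (\<Sum>n. \<integral>\<^sup>+\<omega>. ennreal (d n \<omega>) \<partial>M)"
    by (intro nn_integral_suminf) auto
  also have "\<dots> = (\<Sum>n. ennreal (expectation (d n)))"
    using int nn by (subst nn_integral_eq_integral) auto
  also have "\<dots> = ennreal (\<Sum>n. expectation (d n))"
    using nn sm by (intro suminf_ennreal2) (auto intro!: Bochner_Integration.integral_nonneg)
  finally show eq: "(\<integral>\<^sup>+\<omega>. (\<Sum>n. ennreal (d n \<omega>)) \<partial>M) = ennreal (\<Sum>n. expectation (d n))" .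
  have "AE \<omega> in M. (\<Sum>n. ennreal (d n \<omega>)) \<noteq> \<infinity>"
    using eq by (intro nn_integral_PInf_AE) auto
  then show "AE \<omega> in M. summable (\<lambda>n. d n \<omega>)"
    using AE_space by eventually_elim (use nn in \<open>auto intro: summable_suminf_not_top\<close>)
qed

text \<open>Nonnegativity of the variance.\<close>

lemma expectation_le_sqrt:
  fixes d :: "'a \<Rightarrow> real"
  assumes "integrable M d" "integrable M (\<lambda>\<omega>. (d \<omega>)\<^sup>2)"
  shows "expectation d \<le> sqrt (expectation (\<lambda>\<omega>. (d \<omega>)\<^sup>2))"
  using variance_eq[OF assms] variance_positive[of d] by (intro real_le_rsqrt) simp

text \<open>Integrability makes the integrals of the positive and the negative part finite, so the
  difference in \<open>ereal_expectation\<close> is an ordinary real subtraction.\<close>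

lemma ereal_expectation_ereal:
  assumes "integrable M y" "\<And>\<omega>. \<omega> \<in> space M \<Longrightarrow> Y \<omega> = ereal (y \<omega>)"
  shows "ereal_expectation M Y = ereal (expectation y)"
proof -
  have eq: "(\<integral>\<^sup>+\<omega>. e2ennreal (Y \<omega>) \<partial>M) = (\<integral>\<^sup>+\<omega>. ennreal (y \<omega>) \<partial>M)"
    "(\<integral>\<^sup>+\<omega>. e2ennreal (- Y \<omega>) \<partial>M) = (\<integral>\<^sup>+\<omega>. ennreal (- y \<omega>) \<partial>M)"
    using assms(2) by (auto intro!: nn_integral_cong simp: e2ennreal_ereal)
  have fin: "(\<integral>\<^sup>+\<omega>. ennreal (y \<omega>) \<partial>M) \<noteq> \<infinity>" "(\<integral>\<^sup>+\<omega>. ennreal (- y \<omega>) \<partial>M) \<noteq> \<infinity>"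
    using assms(1) by (auto simp: real_integrable_def)
  show ?thesis
    unfolding ereal_expectation_def eq real_lebesgue_integral_def[OF assms(1)]
    using fin by (cases "\<integral>\<^sup>+\<omega>. ennreal (y \<omega>) \<partial>M" rule: ennreal_cases;
        cases "\<integral>\<^sup>+\<omega>. ennreal (- y \<omega>) \<partial>M" rule: ennreal_cases) auto
qed

end

text \<open>Writes the iterates as a deterministic function of the selection sequence, so that
  \<open>x n\<close> visibly depends on the first \<open>n\<close> selections only.\<close>

primrec random_iterate :: "('s \<Rightarrow> 'e \<Rightarrow> 's) \<Rightarrow> 's \<Rightarrow> (nat \<Rightarrow> 'e) \<Rightarrow> nat \<Rightarrow> 's" where
  "random_iterate \<Phi> s e 0 = s"
| "random_iterate \<Phi> s e (Suc n) = \<Phi> (random_iterate \<Phi> s e n) (e n)"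

lemma random_iterate_restrict:
  "n \<le> N \<Longrightarrow> random_iterate \<Phi> s (restrict e {..<N}) n = random_iterate \<Phi> s e n"
  by (induction n) auto

lemma finite_range_random_iterate:
  fixes \<Phi> :: "'s \<Rightarrow> 'e::finite \<Rightarrow> 's"
  shows "finite (range (\<lambda>e. random_iterate \<Phi> s e n))"
proof (induction n)
  case (Suc n)
  have "range (\<lambda>e. random_iterate \<Phi> s e (Suc n))
      \<subseteq> case_prod \<Phi> ` (range (\<lambda>e. random_iterate \<Phi> s e n) \<times> UNIV)"
    by auto
  then show ?case by (rule finite_subset) (use Suc in simp)
qed simp

text \<open>The index set \<open>{..<N}\<close> stays fixed while the induction runs over
  \<open>n\<close>, so every step lives on the same product space. The update by \<open>e n\<close>
  is measurable because \<open>e n\<close> has finitely many values.\<close>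

lemma measurable_random_iterate:
  fixes \<Phi> :: "'s \<Rightarrow> 'e::finite \<Rightarrow> 's"
  assumes "n \<le> N"
  shows "(\<lambda>e. random_iterate \<Phi> s e n) \<in> measurable (PiM {..<N} (\<lambda>_. count_space UNIV)) (count_space UNIV)"
  using assms
proof (induction n)
  case (Suc n)
  let ?P = "PiM {..<N} (\<lambda>_. count_space (UNIV :: 'e set))"
  have comp: "(\<lambda>e. e n) \<in> measurable ?P (count_space UNIV)"
    using Suc.prems by (intro measurable_component_singleton) auto
  have "(\<lambda>e. \<Phi> (random_iterate \<Phi> s e n) i) \<in> measurable ?P (count_space UNIV)" for i
    using Suc by (intro measurable_compose[OF Suc.IH, of "\<lambda>y. \<Phi> y i"]) auto
  then have "(\<lambda>e. \<Phi> (random_iterate \<Phi> s e n) (e n)) \<in> measurable ?P (count_space UNIV)"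
    by (rule measurable_compose_countable'[where f = "\<lambda>i e. \<Phi> (random_iterate \<Phi> s e n) i", OF _ comp])
      (simp add: countable_finite)
  then show ?case by simp
qed simp

text \<open>The iterate is a function of the coordinates below \<open>n\<close>, hence independent
  of \<open>eps n\<close>. The last claim is the tower rule: average over the fresh selection first,
  with the current point frozen.\<close>

lemma (in prob_space)
  fixes eps :: "nat \<Rightarrow> 'a \<Rightarrow> 'e::finite" and \<Phi> :: "'s \<Rightarrow> 'e \<Rightarrow> 's"
  assumes ind: "indep_vars (\<lambda>_. count_space UNIV) eps UNIV"
    and x_0: "\<And>\<omega>. \<omega> \<in> space M \<Longrightarrow> x 0 \<omega> = s"
    and x_Suc: "\<And>n \<omega>. \<omega> \<in> space M \<Longrightarrow> x (Suc n) \<omega> = \<Phi> (x n \<omega>) (eps n \<omega>)"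
  shows measurable_random_iteration: "x n \<in> measurable M (count_space UNIV)"
    and finite_range_random_iteration: "finite (x n ` space M)"
    and expectation_random_iteration: "\<And>\<phi> :: 's \<Rightarrow> 'e \<Rightarrow> real.
      expectation (\<lambda>\<omega>. \<phi> (x n \<omega>) (eps n \<omega>)) = expectation (\<lambda>\<omega>. expectation (\<lambda>\<omega>'. \<phi> (x n \<omega>) (eps n \<omega>')))"
proof -
  let ?R = "\<lambda>e. random_iterate \<Phi> s e n"
  let ?past = "\<lambda>\<omega>. restrict (\<lambda>i. eps i \<omega>) {..<n}"
  have x: "x n \<omega> = ?R (?past \<omega>)" if "\<omega> \<in> space M" for \<omega>
  proof -
    have "x n \<omega> = ?R (\<lambda>k. eps k \<omega>)"
      by (induction n) (auto simp: x_0 x_Suc that)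
    then show ?thesis by (simp add: random_iterate_restrict)
  qed
  have indr: "indep_var (PiM {..<n} (\<lambda>_. count_space UNIV)) ?past
      (PiM {n} (\<lambda>_. count_space UNIV)) (\<lambda>\<omega>. restrict (\<lambda>i. eps i \<omega>) {n})"
    using ind by (rule indep_var_restrict) auto
  have R: "?R \<in> measurable (PiM {..<n} (\<lambda>_. count_space UNIV)) (count_space UNIV)"
    by (rule measurable_random_iterate) simp
  have comp: "(\<lambda>e. e n) \<in> measurable (PiM {n} (\<lambda>_. count_space (UNIV :: 'e set))) (count_space UNIV)"
    by (intro measurable_component_singleton) auto
  have "(\<lambda>\<omega>. ?R (?past \<omega>)) \<in> measurable M (count_space UNIV)"
    using measurable_compose[OF indep_var_rv1[OF indr] R] .
  then show Y: "x n \<in> measurable M (count_space UNIV)"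
    by (subst measurable_cong[OF x])
  have Z: "eps n \<in> measurable M (count_space UNIV)"
    using ind unfolding indep_vars_def by blast
  have "x n ` space M \<subseteq> range ?R" using x by auto
  then show fin: "finite (x n ` space M)"
    by (rule finite_subset) (rule finite_range_random_iterate)
  have prod: "prob ((\<lambda>\<omega>. (x n \<omega>, eps n \<omega>)) -` {(a, e)} \<inter> space M)
      = prob (x n -` {a} \<inter> space M) * prob (eps n -` {e} \<inter> space M)" for a e
  proof -
    let ?A = "?R -` {a} \<inter> space (PiM {..<n} (\<lambda>_. count_space UNIV))"
    let ?B = "(\<lambda>g. g n) -` {e} \<inter> space (PiM {n} (\<lambda>_. count_space UNIV))"
    have "?A \<in> sets (PiM {..<n} (\<lambda>_. count_space UNIV))" "?B \<in> sets (PiM {n} (\<lambda>_. count_space UNIV))"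
      using measurable_sets[OF R, of "{a}"] measurable_sets[OF comp, of "{e}"] by simp_all
    note D = indep_varD[OF indr this]
    have mem: "?past \<omega> \<in> space (PiM {..<n} (\<lambda>_. count_space UNIV))"
      "restrict (\<lambda>i. eps i \<omega>) {n} \<in> space (PiM {n} (\<lambda>_. count_space UNIV))" for \<omega>
      by (simp_all add: space_PiM)
    have "(\<lambda>\<omega>. (?past \<omega>, restrict (\<lambda>i. eps i \<omega>) {n})) -` (?A \<times> ?B) \<inter> space M
        = (\<lambda>\<omega>. (x n \<omega>, eps n \<omega>)) -` {(a, e)} \<inter> space M"
      "?past -` ?A \<inter> space M = x n -` {a} \<inter> space M"
      "(\<lambda>\<omega>. restrict (\<lambda>i. eps i \<omega>) {n}) -` ?B \<inter> space M = eps n -` {e} \<inter> space M"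
      by (auto simp: mem x)
    with D show ?thesis by simp
  qed
  show "expectation (\<lambda>\<omega>. \<phi> (x n \<omega>) (eps n \<omega>)) = expectation (\<lambda>\<omega>. expectation (\<lambda>\<omega>'. \<phi> (x n \<omega>) (eps n \<omega>')))"
    for \<phi> :: "'s \<Rightarrow> 'e \<Rightarrow> real"
    by (rule expectation_indep_finite[OF Y Z prod fin])
qed

section \<open>One forward-backward step\<close>

locale block_composite =
  fixes V :: "'m::finite \<Rightarrow> 'a::{real_inner, banach} set"
    and f :: "'a ^ 'm \<Rightarrow> real"
    and grad :: "'a ^ 'm \<Rightarrow> 'a ^ 'm"
    and h :: "'m \<Rightarrow> 'a \<Rightarrow> ereal"
    and \<gamma> :: "'m \<Rightarrow> real"
  assumes subspace_V: "\<And>i. subspace (V i)" and closed_V: "\<And>i. closed (V i)"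
    and f_convex: "convex_on (direct_sum V) f"
    and f_derivative: "\<And>y. y \<in> direct_sum V \<Longrightarrow>
      (f has_derivative (\<lambda>v. inner (grad y) v)) (at y within direct_sum V)"
    and h_proper: "\<And>i. proper_on (V i) (h i)" and h_convex: "\<And>i. convex_ereal_on (V i) (h i)"
    and h_lsc: "\<And>i. lsc_on (V i) (h i)"
    and \<gamma>_pos: "\<And>i. 0 < \<gamma> i"
begin

abbreviation step :: "'a ^ 'm \<Rightarrow> 'a ^ 'm" where
  "step y \<equiv> fb_step V h grad \<gamma> y - y"

definition objective :: "'a ^ 'm \<Rightarrow> ereal" where
  "objective y = ereal (f y) + separable_sum h y"

definition domain :: "('a ^ 'm) set" where
  "domain = {y \<in> direct_sum V. \<forall>i. h i (y $ i) \<noteq> \<infinity>}"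

text \<open>Real-valued so that differences and expectations make sense. Off \<open>domain\<close>,
  \<open>real_of_ereal\<close> replaces an infinite value by 0, so the objective is represented on
  \<open>domain\<close> only.\<close>

definition real_objective :: "'a ^ 'm \<Rightarrow> real" where
  "real_objective y = f y + (\<Sum>i\<in>UNIV. real_of_ereal (h i (y $ i)))"

text \<open>The share of block \<open>i\<close>, before weighting by \<open>p i\<close>, in the
  bound on the expected change of the objective.\<close>

definition block_gain :: "('m \<Rightarrow> real) \<Rightarrow> 'a ^ 'm \<Rightarrow> 'm \<Rightarrow> real" where
  "block_gain \<nu> y i = real_of_ereal (h i (fb_step V h grad \<gamma> y $ i)) - real_of_ereal (h i (y $ i))
     + inner (grad y $ i) (step y $ i) + \<nu> i / 2 * (norm (step y $ i))\<^sup>2"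

lemma subspace_H: "subspace (direct_sum V)"
  using subspace_V by (auto simp: subspace_def direct_sum_def)

lemma closed_H: "closed (direct_sum V)"
proof -
  have "direct_sum V = (\<Inter>i. (\<lambda>y. y $ i) -` V i)" by (auto simp: direct_sum_def)
  then show ?thesis
    using closed_V by (auto intro!: closed_INT continuous_closed_vimage continuous_intros)
qed

lemma objective_real:
  assumes "y \<in> domain"
  shows "objective y = ereal (real_objective y)"
proof -
  have "h i (y $ i) = ereal (real_of_ereal (h i (y $ i)))" for i
    using assms h_proper[of i] by (auto simp: domain_def proper_on_def direct_sum_def ereal_real)
  then have "separable_sum h y = (\<Sum>i\<in>UNIV. ereal (real_of_ereal (h i (y $ i))))"
    unfolding separable_sum_def by (intro sum.cong) auto
  then show ?thesis by (simp add: objective_def real_objective_def)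
qed

lemma domain_iff: "y \<in> domain \<longleftrightarrow> y \<in> direct_sum V \<and> separable_sum h y < \<infinity>"
  by (auto simp: domain_def separable_sum_def sum_Pinfty less_top[symmetric] top_ereal_def)

lemma objective_infinite: "y \<in> direct_sum V \<Longrightarrow> y \<notin> domain \<Longrightarrow> objective y = \<infinity>"
  by (auto simp: domain_iff objective_def)

lemma
  assumes y: "y \<in> direct_sum V"
  shows fb_step_domain: "fb_step V h grad \<gamma> y \<in> domain"
    and fb_step_variational: "\<And>z i. z \<in> V i \<Longrightarrow> h i z \<noteq> \<infinity> \<Longrightarrow>
      \<gamma> i * real_of_ereal (h i (fb_step V h grad \<gamma> y $ i))
        + inner (- (step y $ i) - \<gamma> i *\<^sub>R grad y $ i) (z - fb_step V h grad \<gamma> y $ i)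
      \<le> \<gamma> i * real_of_ereal (h i z)"
proof -
  have P: "fb_step V h grad \<gamma> y $ i
      = prox (V i) (\<lambda>z. ereal (\<gamma> i) * h i z) (y $ i - \<gamma> i *\<^sub>R grad y $ i)" for i
    by (simp add: fb_step_def)
  show "fb_step V h grad \<gamma> y \<in> domain"
    using prox_variational_inequality(1,2)[OF closed_V h_proper h_convex h_lsc \<gamma>_pos] by (auto simp: domain_def direct_sum_def P)
  show "\<gamma> i * real_of_ereal (h i (fb_step V h grad \<gamma> y $ i))
        + inner (- (step y $ i) - \<gamma> i *\<^sub>R grad y $ i) (z - fb_step V h grad \<gamma> y $ i)
      \<le> \<gamma> i * real_of_ereal (h i z)" if "z \<in> V i" "h i z \<noteq> \<infinity>" for z i
  proof -
    have "- (step y $ i) - \<gamma> i *\<^sub>R grad y $ i = y $ i - \<gamma> i *\<^sub>R grad y $ i - fb_step V h grad \<gamma> y $ i"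
      by simp
    then show ?thesis
      using prox_variational_inequality(3)[OF closed_V h_proper h_convex h_lsc \<gamma>_pos[of i] that,
          of "y $ i - \<gamma> i *\<^sub>R grad y $ i", folded P] by (simp only:)
  qed
qed

lemma block_update_domain:
  assumes "y \<in> domain"
  shows "y + e \<odot> step y \<in> domain"
proof -
  have y: "y \<in> direct_sum V" using assms by (simp add: domain_def)
  have "(y + e \<odot> step y) $ i = (if e i then fb_step V h grad \<gamma> y $ i else y $ i)" for i
    by (simp add: block_select_def)
  then show ?thesis
    using assms fb_step_domain[OF y] by (auto simp: domain_def direct_sum_def)
qed

text \<open>Expanding the variational inequality and dividing by \<open>\<gamma> i\<close> yields
  the squared step over \<open>\<gamma> i\<close> with coefficient -1. The curvature term in
  \<open>block_gain\<close> costs at most \<open>\<delta> / 2\<close> of it, which leaves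
  \<open>(2 - \<delta>) / 2\<close>.\<close>

lemma block_gain_le:
  assumes y: "y \<in> direct_sum V" and z: "z \<in> V i" "h i z \<noteq> \<infinity>" and \<delta>: "\<gamma> i * \<nu> i \<le> \<delta>"
  shows "block_gain \<nu> y i \<le> real_of_ereal (h i z) - real_of_ereal (h i (y $ i))
    + inner (grad y $ i) (z - y $ i) + 1 / \<gamma> i * inner (step y $ i) (z - y $ i)
    - (2 - \<delta>) / 2 * (1 / \<gamma> i * (norm (step y $ i))\<^sup>2)"
proof -
  define T where "T = fb_step V h grad \<gamma> y $ i"
  define v where "v = step y $ i"
  have T: "T = y $ i + v" by (simp add: T_def v_def)
  have g: "0 < \<gamma> i" by (rule \<gamma>_pos)
  have "\<gamma> i * real_of_ereal (h i T) + inner (- v - \<gamma> i *\<^sub>R grad y $ i) (z - T)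
      \<le> \<gamma> i * real_of_ereal (h i z)"
    using fb_step_variational[OF y z] by (simp add: T_def v_def)
  moreover have "inner (- v - \<gamma> i *\<^sub>R grad y $ i) (z - T)
      = (norm v)\<^sup>2 - inner v (z - y $ i) - \<gamma> i * inner (grad y $ i) (z - y $ i) + \<gamma> i * inner (grad y $ i) v"
    unfolding T by (simp add: inner_diff_left inner_diff_right inner_add_right power2_norm_eq_inner algebra_simps)
  moreover have "\<gamma> i * \<nu> i * (norm v)\<^sup>2 \<le> \<delta> * (norm v)\<^sup>2"
    using \<delta> by (intro mult_right_mono) auto
  ultimately have "\<gamma> i * block_gain \<nu> y i \<le> \<gamma> i * (real_of_ereal (h i z) - real_of_ereal (h i (y $ i))
    + inner (grad y $ i) (z - y $ i)) + inner v (z - y $ i) - (2 - \<delta>) / 2 * (norm v)\<^sup>2"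
    unfolding block_gain_def T_def[symmetric] v_def[symmetric] by (simp add: field_simps)
  also have "\<dots> = \<gamma> i * (real_of_ereal (h i z) - real_of_ereal (h i (y $ i))
    + inner (grad y $ i) (z - y $ i) + 1 / \<gamma> i * inner v (z - y $ i)
    - (2 - \<delta>) / 2 * (1 / \<gamma> i * (norm v)\<^sup>2))"
    using g by (simp add: field_simps)
  finally show ?thesis using g unfolding v_def by (simp only: mult_le_cancel_left_pos)
qed

text \<open>At \<open>z = y $ i\<close> every term except the squared step vanishes.\<close>

lemma block_gain_le_step:
  assumes "y \<in> domain" "\<gamma> i * \<nu> i \<le> \<delta>"
  shows "block_gain \<nu> y i \<le> - ((2 - \<delta>) / 2 * (1 / \<gamma> i * (norm (step y $ i))\<^sup>2))"
  using block_gain_le[of y "y $ i" i \<nu> \<delta>] assms by (simp add: domain_def direct_sum_def)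

text \<open>Summed over the blocks, the gradient terms form \<open>inner (grad y) (z - y)\<close>,
  which convexity bounds by \<open>f z - f y\<close>; the step terms are bounded by Cauchy-Schwarz
  in the weighted inner product.\<close>

lemma sum_block_gain_le:
  assumes y: "y \<in> domain" and z: "z \<in> domain" and \<delta>: "\<And>i. \<gamma> i * \<nu> i \<le> \<delta>"
  shows "(\<Sum>i\<in>UNIV. block_gain \<nu> y i) \<le> real_objective z - real_objective y
    + wnorm (\<lambda>i. 1 / \<gamma> i) (step y) * wnorm (\<lambda>i. 1 / \<gamma> i) (y - z)
    - (2 - \<delta>) / 2 * (wnorm (\<lambda>i. 1 / \<gamma> i) (step y))\<^sup>2"
proof -
  have H: "y \<in> direct_sum V" "z \<in> direct_sum V" using y z by (auto simp: domain_def)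
  have g: "0 \<le> 1 / \<gamma> i" for i using \<gamma>_pos[of i] by simp
  have "(\<Sum>i\<in>UNIV. block_gain \<nu> y i) \<le> (\<Sum>i\<in>UNIV. real_of_ereal (h i (z $ i)) - real_of_ereal (h i (y $ i))
    + inner (grad y $ i) ((z - y) $ i) + 1 / \<gamma> i * inner (step y $ i) ((z - y) $ i)
    - (2 - \<delta>) / 2 * (1 / \<gamma> i * (norm (step y $ i))\<^sup>2))"
    using block_gain_le[where \<nu> = \<nu> and \<delta> = \<delta>, OF H(1)] z \<delta>
    by (intro sum_mono) (auto simp: domain_def direct_sum_def)
  also have "\<dots> = (\<Sum>i\<in>UNIV. real_of_ereal (h i (z $ i))) - (\<Sum>i\<in>UNIV. real_of_ereal (h i (y $ i)))
    + inner (grad y) (z - y) + (\<Sum>i\<in>UNIV. 1 / \<gamma> i * inner (step y $ i) ((z - y) $ i))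
    - (2 - \<delta>) / 2 * (wnorm (\<lambda>i. 1 / \<gamma> i) (step y))\<^sup>2"
    unfolding wnorm_power2[OF g] inner_vec_def
    by (simp only: sum.distrib sum_subtractf sum_distrib_left)
  also have "\<dots> \<le> (\<Sum>i\<in>UNIV. real_of_ereal (h i (z $ i))) - (\<Sum>i\<in>UNIV. real_of_ereal (h i (y $ i)))
    + (f z - f y) + wnorm (\<lambda>i. 1 / \<gamma> i) (step y) * wnorm (\<lambda>i. 1 / \<gamma> i) (z - y)
    - (2 - \<delta>) / 2 * (wnorm (\<lambda>i. 1 / \<gamma> i) (step y))\<^sup>2"
    using convex_gradient_inequality[OF subspace_H f_convex H f_derivative[OF H(1)]]
      wnorm_Cauchy_Schwarz[of "\<lambda>i. 1 / \<gamma> i", OF g, of "step y" "z - y"] by linarith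
  also have "wnorm (\<lambda>i. 1 / \<gamma> i) (z - y) = wnorm (\<lambda>i. 1 / \<gamma> i) (y - z)"
    by (simp add: wnorm_def norm_minus_commute)
  finally show ?thesis by (simp add: real_objective_def)
qed

lemma sum_block_gain_le_error_bound:
  assumes y: "y \<in> domain" and \<delta>: "\<And>i. \<gamma> i * \<nu> i \<le> \<delta>" and \<delta>2: "\<delta> \<le> 2" and c: "c > 0"
    and S: "S \<noteq> {}" "S \<subseteq> domain" "\<And>z. z \<in> S \<Longrightarrow> real_objective z = m"
    and eb: "wdist (\<lambda>i. 1 / \<gamma> i) y S \<le> c * wnorm (\<lambda>i. 1 / \<gamma> i) (y - fb_step V h grad \<gamma> y)"
  shows "(\<Sum>i\<in>UNIV. block_gain \<nu> y i) \<le> - (min 1 ((2 - \<delta>) / (2 * c)) * (real_objective y - m))"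
proof -
  define D where "D = wnorm (\<lambda>i. 1 / \<gamma> i) (step y)"
  define s where "s = (\<Sum>i\<in>UNIV. block_gain \<nu> y i)"
  define a where "a = (2 - \<delta>) / 2"
  have g: "0 \<le> 1 / \<gamma> i" for i using \<gamma>_pos[of i] by simp
  have D: "0 \<le> D" unfolding D_def by (rule wnorm_nonneg[OF g])
  have "wnorm (\<lambda>i. 1 / \<gamma> i) (y - fb_step V h grad \<gamma> y) = D"
    by (simp add: D_def wnorm_def norm_minus_commute)
  with eb have eb: "wdist (\<lambda>i. 1 / \<gamma> i) y S \<le> c * D" by simp
  have s1: "s \<le> - (a * D\<^sup>2)"
  proof -
    have "s \<le> (\<Sum>i\<in>UNIV. - (a * (1 / \<gamma> i * (norm (step y $ i))\<^sup>2)))"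
      unfolding s_def a_def by (intro sum_mono block_gain_le_step y \<delta>)
    then show ?thesis
      unfolding D_def wnorm_power2[OF g] by (simp only: sum_negf sum_distrib_left)
  qed
  have sz: "s \<le> m - real_objective y + D * wnorm (\<lambda>i. 1 / \<gamma> i) (y - z) - a * D\<^sup>2" if "z \<in> S" for z
    using sum_block_gain_le[OF y _ \<delta>, of z] S that by (auto simp: s_def a_def D_def)
  \<comment> \<open>The infimum over \<open>S\<close> need not be attained, so the bound for each
    \<open>z\<close> is solved for the distance before the infimum is taken. This divides by
    \<open>D\<close>, hence the separate case \<open>D = 0\<close>.\<close>
  have s2: "s \<le> - (real_objective y - m) + (c - a) * D\<^sup>2"
  proof (cases "D = 0")
    case True
    then show ?thesis using sz S(1) by fastforce
  next
    case False
    then have D: "0 < D" using D by simp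
    have "(s - m + real_objective y + a * D\<^sup>2) / D \<le> wdist (\<lambda>i. 1 / \<gamma> i) y S"
      unfolding wdist_def
    proof (rule cINF_greatest[OF S(1)])
      fix z assume "z \<in> S"
      from sz[OF this] D show "(s - m + real_objective y + a * D\<^sup>2) / D \<le> wnorm (\<lambda>i. 1 / \<gamma> i) (y - z)"
        by (simp add: pos_divide_le_eq mult.commute)
    qed
    with eb have "(s - m + real_objective y + a * D\<^sup>2) / D \<le> c * D" by linarith
    then show ?thesis using D by (simp add: pos_divide_le_eq power2_eq_square algebra_simps)
  qed
  show ?thesis
  \<comment> \<open>For \<open>c \<le> a\<close> the second bound alone suffices, since its
    coefficient of \<open>D\<^sup>2\<close> is nonpositive.\<close>
  proof (cases "c \<le> a")
    case True
    then have "min 1 ((2 - \<delta>) / (2 * c)) = 1" using c by (simp add: a_def field_simps)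
    moreover have "(c - a) * D\<^sup>2 \<le> 0" using True by (simp add: mult_nonpos_nonneg)
    ultimately show ?thesis using s2 by (simp add: s_def)
  next
    case False
    \<comment> \<open>The weight for which the coefficient of \<open>D\<^sup>2\<close> in the
      combination, \<open>k * c - a\<close>, vanishes.\<close>
    define k where "k = a / c"
    have k: "min 1 ((2 - \<delta>) / (2 * c)) = k" "0 \<le> k" "k < 1" "k * c = a"
      using False c \<delta>2 by (auto simp: k_def a_def field_simps min_def)
    have "s = k * s + (1 - k) * s" by (simp add: algebra_simps)
    also have "\<dots> \<le> k * (- (real_objective y - m) + (c - a) * D\<^sup>2) + (1 - k) * - (a * D\<^sup>2)"
      using k by (intro add_mono mult_left_mono s1 s2) auto
    also have "\<dots> = - (k * (real_objective y - m)) + (k * c - a) * D\<^sup>2"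
      by (simp add: algebra_simps)
    finally show ?thesis using k by (simp add: s_def)
  qed
qed

text \<open>The terms from \<open>h\<close> and from the gradient are linear in
  \<open>of_bool (\<epsilon> \<omega> i)\<close>, so their expectations carry the factor
  \<open>p i\<close>. Only \<open>f\<close> sees the joint law of the selection, and
  \<open>smooth\<close> controls it; blocks may therefore be selected dependently.\<close>

lemma expected_descent:
  assumes M: "prob_space M" and \<epsilon>: "\<epsilon> \<in> measurable M (count_space UNIV)"
    and p: "\<And>i. p i = measure M {\<omega> \<in> space M. \<epsilon> \<omega> i}"
    and smooth: "\<And>y v. y \<in> direct_sum V \<Longrightarrow> v \<in> direct_sum V \<Longrightarrow>
      (\<integral>\<omega>. f (y + \<epsilon> \<omega> \<odot> v) \<partial>M)
        \<le> f y + (\<integral>\<omega>. inner (grad y) (\<epsilon> \<omega> \<odot> v) \<partial>M)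
            + 1 / 2 * (\<Sum>i\<in>UNIV. p i * \<nu> i * (norm (v $ i))\<^sup>2)"
    and y: "y \<in> domain"
  shows "(\<integral>\<omega>. real_objective (y + \<epsilon> \<omega> \<odot> step y) \<partial>M)
    \<le> real_objective y + (\<Sum>i\<in>UNIV. p i * block_gain \<nu> y i)"
proof -
  interpret prob_space M by (rule M)
  note int = integrable_finite_rv[OF \<epsilon>]
  have H: "y \<in> direct_sum V" using y by (auto simp: domain_def)
  have v: "step y \<in> direct_sum V"
    using fb_step_domain[OF H] H by (intro subspace_diff[OF subspace_H]) (auto simp: domain_def)
  have P: "(\<integral>\<omega>. (of_bool (\<epsilon> \<omega> i) :: real) \<partial>M) = p i" for i
    using integral_of_bool[of M \<epsilon>] p by simp
  define r where "r i = real_of_ereal (h i (fb_step V h grad \<gamma> y $ i)) - real_of_ereal (h i (y $ i))" for i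
  have "real_objective (y + e \<odot> step y) = f (y + e \<odot> step y)
      + (\<Sum>i\<in>UNIV. real_of_ereal (h i (y $ i)) + of_bool (e i) * r i)" for e
    by (auto simp: real_objective_def r_def block_select_def intro!: sum.cong)
  then have "(\<integral>\<omega>. real_objective (y + \<epsilon> \<omega> \<odot> step y) \<partial>M)
      = (\<integral>\<omega>. f (y + \<epsilon> \<omega> \<odot> step y) \<partial>M)
        + (\<integral>\<omega>. (\<Sum>i\<in>UNIV. real_of_ereal (h i (y $ i)) + of_bool (\<epsilon> \<omega> i) * r i) \<partial>M)"
    by (simp add: int[of "\<lambda>e. f (y + e \<odot> step y)"]
        int[of "\<lambda>e. (\<Sum>i\<in>UNIV. real_of_ereal (h i (y $ i)) + of_bool (e i) * r i)"])
  also have "(\<integral>\<omega>. (\<Sum>i\<in>UNIV. real_of_ereal (h i (y $ i)) + of_bool (\<epsilon> \<omega> i) * r i) \<partial>M)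
      = (\<Sum>i\<in>UNIV. real_of_ereal (h i (y $ i)) + p i * r i)"
    by (subst Bochner_Integration.integral_sum)
      (auto simp: int[of "\<lambda>e. of_bool (e i)" for i] P prob_space int[of "\<lambda>e. real_of_ereal (h i (y $ i)) + of_bool (e i) * r i" for i])
  also have "(\<integral>\<omega>. f (y + \<epsilon> \<omega> \<odot> step y) \<partial>M) \<le> f y + (\<integral>\<omega>. inner (grad y) (\<epsilon> \<omega> \<odot> step y) \<partial>M)
            + 1 / 2 * (\<Sum>i\<in>UNIV. p i * \<nu> i * (norm (step y $ i))\<^sup>2)"
    by (rule smooth[OF H v])
  also have "(\<integral>\<omega>. inner (grad y) (\<epsilon> \<omega> \<odot> step y) \<partial>M) = (\<Sum>i\<in>UNIV. p i * inner (grad y $ i) (step y $ i))"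
  proof -
    have "inner (grad y) (e \<odot> step y) = (\<Sum>i\<in>UNIV. of_bool (e i) * inner (grad y $ i) (step y $ i))" for e
      unfolding inner_vec_def block_select_def vec_lambda_beta inner_scaleR_right ..
    then show ?thesis
      by (simp only: Bochner_Integration.integral_sum P int[of "\<lambda>e. of_bool (e i) * inner (grad y $ i) (step y $ i)" for i]
          int[of "\<lambda>e. of_bool (e i)" for i] Bochner_Integration.integral_mult_left)
  qed
  finally have "(\<integral>\<omega>. real_objective (y + \<epsilon> \<omega> \<odot> step y) \<partial>M)
      \<le> f y + (\<Sum>i\<in>UNIV. p i * inner (grad y $ i) (step y $ i))
          + 1 / 2 * (\<Sum>i\<in>UNIV. p i * \<nu> i * (norm (step y $ i))\<^sup>2)
        + (\<Sum>i\<in>UNIV. real_of_ereal (h i (y $ i)) + p i * r i)"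
    by simp
  moreover have "(\<Sum>i\<in>UNIV. p i * block_gain \<nu> y i) = (\<Sum>i\<in>UNIV. p i * r i)
      + (\<Sum>i\<in>UNIV. p i * inner (grad y $ i) (step y $ i))
      + 1 / 2 * (\<Sum>i\<in>UNIV. p i * \<nu> i * (norm (step y $ i))\<^sup>2)"
    unfolding sum_distrib_left sum.distrib[symmetric] block_gain_def r_def[symmetric]
    by (intro sum.cong refl) (simp add: distrib_left del: vector_minus_component)
  ultimately show ?thesis
    by (simp add: real_objective_def[of y] sum.distrib del: vector_minus_component)
qed

text \<open>Block \<open>i\<close> is selected with probability \<open>p i\<close>, which cancels
  the \<open>p i\<close> in the weight.\<close>

lemma expected_step_power2:
  assumes M: "prob_space M" and \<epsilon>: "\<epsilon> \<in> measurable M (count_space UNIV)"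
    and p: "\<And>i. p i = measure M {\<omega> \<in> space M. \<epsilon> \<omega> i}" "\<And>i. 0 < p i"
  shows "(\<integral>\<omega>. (wnorm (\<lambda>i. 1 / (\<gamma> i * p i)) (\<epsilon> \<omega> \<odot> v))\<^sup>2 \<partial>M) = (wnorm (\<lambda>i. 1 / \<gamma> i) v)\<^sup>2"
proof -
  interpret prob_space M by (rule M)
  note int = integrable_finite_rv[OF \<epsilon>]
  have g: "0 \<le> 1 / \<gamma> i" "0 \<le> 1 / (\<gamma> i * p i)" for i using \<gamma>_pos[of i] p(2)[of i] by auto
  have P: "(\<integral>\<omega>. (of_bool (\<epsilon> \<omega> i) :: real) \<partial>M) = p i" for i
    using integral_of_bool[of M \<epsilon>] p by simp
  have "(wnorm (\<lambda>i. 1 / (\<gamma> i * p i)) (e \<odot> v))\<^sup>2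
      = (\<Sum>i\<in>UNIV. of_bool (e i) * (1 / (\<gamma> i * p i) * (norm (v $ i))\<^sup>2))" for e
    unfolding wnorm_power2[OF g(2)] by (intro sum.cong) (auto simp: block_select_def)
  then have "(\<integral>\<omega>. (wnorm (\<lambda>i. 1 / (\<gamma> i * p i)) (\<epsilon> \<omega> \<odot> v))\<^sup>2 \<partial>M)
      = (\<Sum>i\<in>UNIV. p i * (1 / (\<gamma> i * p i) * (norm (v $ i))\<^sup>2))"
    by (simp only: Bochner_Integration.integral_sum P int[of "\<lambda>e. of_bool (e i) * (1 / (\<gamma> i * p i) * (norm (v $ i))\<^sup>2)" for i]
          int[of "\<lambda>e. of_bool (e i)" for i] Bochner_Integration.integral_mult_left)
  also have "\<dots> = (\<Sum>i\<in>UNIV. 1 / \<gamma> i * (norm (v $ i))\<^sup>2)"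
    using p(2) by (intro sum.cong) (auto simp: field_simps less_imp_neq[symmetric])
  finally show ?thesis unfolding wnorm_power2[OF g(1)] .
qed

text \<open>Differentiability relative to the closed subspace makes \<open>f\<close> continuous
  there, so its lower limit is a finite limit and can be added to that of \<open>h\<close>.\<close>

lemma objective_lsc:
  assumes u: "\<And>n. u n \<in> direct_sum V" "u \<longlonglongrightarrow> z"
  shows "z \<in> direct_sum V" "objective z \<le> liminf (\<lambda>n. objective (u n))"
proof -
  show z: "z \<in> direct_sum V" using closed_sequentially[OF closed_H] u by blast
  have "(f \<longlongrightarrow> f z) (at z within direct_sum V)"
    using has_derivative_continuous[OF f_derivative[OF z]] by (simp add: continuous_within)
  then have "(\<lambda>n. f (u n)) \<longlonglongrightarrow> f z"
    using z u continuous_within_sequentially[of z "direct_sum V" f]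
    by (auto simp: continuous_within comp_def)
  then have fl: "liminf (\<lambda>n. ereal (f (u n))) = ereal (f z)"
    by (intro lim_imp_Liminf) auto
  have hl: "separable_sum h z \<le> liminf (\<lambda>n. separable_sum h (u n))"
    unfolding separable_sum_def using h_lsc h_proper z u
    by (intro sum_lsc_on_liminf[of _ V]) (auto simp: direct_sum_def intro: tendsto_vec_nth)
  have "objective z \<le> liminf (\<lambda>n. ereal (f (u n))) + liminf (\<lambda>n. separable_sum h (u n))"
    unfolding objective_def fl by (intro add_left_mono hl)
  also have "\<dots> \<le> liminf (\<lambda>n. objective (u n))"
    unfolding objective_def by (rule ereal_liminf_add_mono) (simp add: fl)
  finally show "objective z \<le> liminf (\<lambda>n. objective (u n))" .
qed

end

section \<open>Linear convergence\<close>

theorem theorem4p16: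
  fixes V :: "'m::finite \<Rightarrow> 'a::{real_inner, banach, second_countable_topology} set"
    and f :: "'a ^ 'm \<Rightarrow> real"
    and grad :: "'a ^ 'm \<Rightarrow> 'a ^ 'm"
    and h :: "'m \<Rightarrow> 'a \<Rightarrow> ereal"
    and M :: "'w measure"
    and \<epsilon> :: "'w \<Rightarrow> 'm \<Rightarrow> bool"
    and eps :: "nat \<Rightarrow> 'w \<Rightarrow> 'm \<Rightarrow> bool"
    and \<nu> \<gamma> :: "'m \<Rightarrow> real"
    and x0 :: "'a ^ 'm"
    and x :: "nat \<Rightarrow> 'w \<Rightarrow> 'a ^ 'm"
    and X :: "('a ^ 'm) set"
    and c :: real
  defines "H \<equiv> direct_sum V"
    and "F \<equiv> (\<lambda>y. ereal (f y) + separable_sum h y)"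
    and "p \<equiv> (\<lambda>i. measure M {\<omega> \<in> space M. \<epsilon> \<omega> i})"
    and "\<delta> \<equiv> Max (range (\<lambda>i. \<gamma> i * \<nu> i))"
  defines "p_min \<equiv> Min (range p)"
    and "F_min \<equiv> (INF y\<in>H. F y)"
    and "S_min \<equiv> argmin_set F H"
  defines "rate \<equiv> 1 - p_min * min 1 ((2 - \<delta>) / (2 * c))"
  assumes V: "\<And>i. subspace (V i)" "\<And>i. closed (V i)"
    and f_convex: "convex_on H f"
    and f_gradient: "\<And>y. y \<in> H \<Longrightarrow> grad y \<in> H"
      "\<And>y. y \<in> H \<Longrightarrow> (f has_derivative (\<lambda>v. inner (grad y) v)) (at y within H)"
    and h: "\<And>i. proper_on (V i) (h i)" "\<And>i. convex_ereal_on (V i) (h i)" "\<And>i. lsc_on (V i) (h i)"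
    and M: "prob_space M"
    and \<epsilon>: "\<epsilon> \<in> measurable M (count_space UNIV)"
      "\<And>i. p i > 0"
      "measure M {\<omega> \<in> space M. \<epsilon> \<omega> = (\<lambda>i. False)} = 0"
    and eps_indep: "prob_space.indep_vars M (\<lambda>n. count_space UNIV) eps UNIV"
    and eps_copies: "\<And>n. distr M (count_space UNIV) (eps n) = distr M (count_space UNIV) \<epsilon>"
    and \<nu>_pos: "\<And>i. \<nu> i > 0"
    and smooth: "\<And>y v. y \<in> H \<Longrightarrow> v \<in> H \<Longrightarrow>
      (\<integral>\<omega>. f (y + \<epsilon> \<omega> \<odot> v) \<partial>M)
        \<le> f y + (\<integral>\<omega>. inner (grad y) (\<epsilon> \<omega> \<odot> v) \<partial>M)
            + 1 / 2 * (\<Sum>i\<in>UNIV. p i * \<nu> i * (norm (v $ i))\<^sup>2)"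
    and \<gamma>: "\<And>i. 0 < \<gamma> i" "\<And>i. \<gamma> i < 2 / \<nu> i"
    and x0: "x0 \<in> H" "separable_sum h x0 < \<infinity>"
    and x_0: "\<And>\<omega>. \<omega> \<in> space M \<Longrightarrow> x 0 \<omega> = x0"
    and x_Suc: "\<And>n \<omega> i. \<omega> \<in> space M \<Longrightarrow>
      x (Suc n) \<omega> $ i = x n \<omega> $ i + of_bool (eps n \<omega> i) *\<^sub>R
        (prox (V i) (\<lambda>z. ereal (\<gamma> i) * h i z) (x n \<omega> $ i - \<gamma> i *\<^sub>R grad (x n \<omega>) $ i) - x n \<omega> $ i)"
    and S_min: "S_min \<noteq> {}"
    and X: "X \<subseteq> H" "AE \<omega> in M. \<forall>n. x n \<omega> \<in> X"
    and c: "c > 0"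
    and error_bound: "\<And>y. y \<in> X \<Longrightarrow>
      wdist (\<lambda>i. 1 / \<gamma> i) y S_min \<le> c * wnorm (\<lambda>i. 1 / \<gamma> i) (y - fb_step V h grad \<gamma> y)"
  shows "(\<forall>n. ereal_expectation M (\<lambda>\<omega>. F (x n \<omega>)) - F_min
              \<le> ereal (rate ^ n) * (ereal_expectation M (\<lambda>\<omega>. F (x 0 \<omega>)) - F_min))
       \<and> (\<exists>xs. xs \<in> borel_measurable M \<and> (\<forall>\<omega>\<in>space M. xs \<omega> \<in> S_min)
            \<and> (AE \<omega> in M. (\<lambda>n. x n \<omega>) \<longlonglongrightarrow> xs \<omega>)
            \<and> (\<forall>n. integrable M (\<lambda>\<omega>. wnorm (\<lambda>i. 1 / (\<gamma> i * p i)) (x n \<omega> - xs \<omega>)))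
            \<and> (\<lambda>n. \<integral>\<omega>. wnorm (\<lambda>i. 1 / (\<gamma> i * p i)) (x n \<omega> - xs \<omega>) \<partial>M)
                \<in> O(\<lambda>n. rate powr (real n / 2)))"
proof -
  interpret prob_space M by (rule M)
  interpret block_composite V f grad h \<gamma>
    using V f_convex f_gradient(2) h \<gamma>(1) unfolding H_def by unfold_locales auto
  define \<Phi> where "\<Phi> y e = y + e \<odot> step y" for y e
  define W where "W i = 1 / (\<gamma> i * p i)" for i
  have F: "F = objective" by (simp add: F_def objective_def fun_eq_iff)

  \<comment> \<open>Iterates as random variables, and averaging over a fresh selection\<close>
  have x_Suc': "x (Suc n) \<omega> = \<Phi> (x n \<omega>) (eps n \<omega>)" if "\<omega> \<in> space M" for n \<omega>
    using x_Suc[OF that] by (simp add: vec_eq_iff \<Phi>_def block_select_def fb_step_def)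
  note iter =
    measurable_random_iteration[where x = x and s = x0 and \<Phi> = \<Phi> and eps = eps, OF eps_indep x_0 x_Suc']
    finite_range_random_iteration[where x = x and s = x0 and \<Phi> = \<Phi> and eps = eps, OF eps_indep x_0 x_Suc']
    expectation_random_iteration[where x = x and s = x0 and \<Phi> = \<Phi> and eps = eps, OF eps_indep x_0 x_Suc']
  have int_x: "integrable M (\<lambda>\<omega>. g (x n \<omega>))" for g :: "'a ^ 'm \<Rightarrow> real" and n
    by (rule integrable_finite_range[OF iter(1) iter(2)]) auto
  have eps_meas: "eps n \<in> measurable M (count_space UNIV)" for n
    using eps_indep unfolding indep_vars_def by blast
  have eps_copy: "(\<integral>\<omega>. g (eps n \<omega>) \<partial>M) = (\<integral>\<omega>. g (\<epsilon> \<omega>) \<partial>M)" for g :: "('m \<Rightarrow> bool) \<Rightarrow> real" and n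
    using integral_distr[OF eps_meas[of n], of g] integral_distr[OF \<epsilon>(1), of g]
    by (simp add: eps_copies)
  \<comment> \<open>The fresh selection \<open>eps n\<close> is replaced by
    \<open>\<epsilon>\<close>, which has the same law, so one-step estimates stated for
    \<open>\<epsilon>\<close> apply at every iteration.\<close>
  have step_expectation: "expectation (\<lambda>\<omega>. \<phi> (x n \<omega>) (eps n \<omega>))
      = expectation (\<lambda>\<omega>. (\<integral>\<omega>'. \<phi> (x n \<omega>) (\<epsilon> \<omega>') \<partial>M))"
    for \<phi> :: "'a ^ 'm \<Rightarrow> ('m \<Rightarrow> bool) \<Rightarrow> real" and n
  proof -
    have "expectation (\<lambda>\<omega>. \<phi> (x n \<omega>) (eps n \<omega>))
        = expectation (\<lambda>\<omega>. (\<integral>\<omega>'. \<phi> (x n \<omega>) (eps n \<omega>') \<partial>M))"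
      by (rule iter(3))
    also have "\<dots> = expectation (\<lambda>\<omega>. (\<integral>\<omega>'. \<phi> (x n \<omega>) (\<epsilon> \<omega>') \<partial>M))"
      by (intro Bochner_Integration.integral_cong refl eps_copy)
    finally show ?thesis .
  qed

  have dom0: "x0 \<in> domain" using x0 by (simp add: domain_iff H_def)
  have dom: "x n \<omega> \<in> domain" if "\<omega> \<in> space M" for n \<omega>
    by (induction n) (simp_all add: x_0 x_Suc' \<Phi>_def that dom0 block_update_domain)

  \<comment> \<open>Minimizers and the optimal value\<close>
  have S_iff: "z \<in> S_min \<longleftrightarrow> z \<in> H \<and> (\<forall>y\<in>H. objective z \<le> objective y)" for z
    by (auto simp: S_min_def argmin_set_def is_arg_min_def F not_less)
  \<comment> \<open>An infinite value at a minimizer would force an infinite value at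
    \<open>x0\<close>.\<close>
  have S_dom: "z \<in> domain" if "z \<in> S_min" for z
  proof (rule ccontr)
    assume "z \<notin> domain"
    then have "objective z = \<infinity>" using that objective_infinite[of z] by (simp add: S_iff H_def)
    then have "objective x0 = \<infinity>" using that x0(1) by (auto simp: S_iff)
    then show False using objective_real[OF dom0] by simp
  qed
  obtain s0 where s0: "s0 \<in> S_min" using S_min by blast
  define m where "m = real_objective s0"
  have S_val: "real_objective z = m" if "z \<in> S_min" for z
  proof -
    have "objective z = objective s0"
      using that s0 by (intro antisym) (auto simp: S_iff)
    then show ?thesis using S_dom[OF that] S_dom[OF s0] by (simp add: objective_real m_def)
  qed
  have m_le: "m \<le> real_objective y" if "y \<in> domain" for y
  proof -
    have "objective s0 \<le> objective y" using s0 that by (auto simp: S_iff domain_def H_def)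
    then show ?thesis using S_dom[OF s0] that by (simp add: objective_real m_def)
  qed
  have F_min: "F_min = ereal m"
  proof -
    have "F_min = objective s0"
      unfolding F_min_def F using s0 by (intro antisym INF_lower INF_greatest) (auto simp: S_iff)
    then show ?thesis using S_dom[OF s0] by (simp add: objective_real m_def)
  qed

  \<comment> \<open>Constants and the range of the rate\<close>
  have \<delta>: "\<gamma> i * \<nu> i \<le> \<delta>" for i by (simp add: \<delta>_def)
  have \<delta>2: "\<delta> < 2"
    unfolding \<delta>_def using \<gamma>(2) \<nu>_pos by (subst Max_less_iff) (auto simp: pos_less_divide_eq)
  have pm: "p_min \<le> p i" for i by (simp add: p_min_def)
  have pm0: "0 < p_min" unfolding p_min_def using \<epsilon>(2) by (subst Min_gr_iff) auto
  \<comment> \<open>\<open>undefined\<close> serves as an arbitrary index.\<close>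
  have pm1: "p_min \<le> 1" using pm[of undefined] by (simp add: p_def order_trans[OF _ prob_le_1])
  define a where "a = (2 - \<delta>) / 2"
  have a: "0 < a" using \<delta>2 by (simp add: a_def)
  define \<kappa> where "\<kappa> = min 1 ((2 - \<delta>) / (2 * c))"
  have \<kappa>: "0 < \<kappa>" "\<kappa> \<le> 1" using \<delta>2 c by (auto simp: \<kappa>_def)
  have rate: "rate = 1 - p_min * \<kappa>" by (simp add: rate_def \<kappa>_def)
  have rate0: "0 \<le> rate" using mult_mono[OF pm1 \<kappa>(2)] \<kappa> pm0 by (simp add: rate)
  have rate1: "rate < 1" using \<kappa> pm0 by (simp add: rate)
  have W: "0 < W i" for i using \<gamma>(1) \<epsilon>(2) by (simp add: W_def)
  have W0: "0 \<le> W i" for i using W less_imp_le by blast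
  have g0: "0 \<le> 1 / \<gamma> i" for i using \<gamma>(1)[of i] by simp

  \<comment> \<open>One-step estimates in expectation from a deterministic point\<close>
  define \<psi> where "\<psi> y = (\<integral>\<omega>. real_objective (\<Phi> y (\<epsilon> \<omega>)) \<partial>M)" for y
  define D where "D y = wnorm (\<lambda>i. 1 / \<gamma> i) (step y)" for y
  have gain_nonpos: "block_gain \<nu> y i \<le> 0" if "y \<in> domain" for y i
  proof -
    have "0 \<le> (2 - \<delta>) / 2 * (1 / \<gamma> i * (norm (step y $ i))\<^sup>2)"
      using \<delta>2 g0[of i] by (intro mult_nonneg_nonneg) auto
    then show ?thesis using block_gain_le_step[where \<nu> = \<nu>, OF that \<delta>, of i] by linarith
  qed
  have \<psi>_le: "\<psi> y \<le> real_objective y + p_min * (\<Sum>i\<in>UNIV. block_gain \<nu> y i)" if y: "y \<in> domain" for y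
  proof -
    have "\<psi> y \<le> real_objective y + (\<Sum>i\<in>UNIV. p i * block_gain \<nu> y i)"
      unfolding \<psi>_def \<Phi>_def using smooth unfolding H_def
      by (intro expected_descent[OF M \<epsilon>(1) _ _ y]) (auto simp: p_def)
    \<comment> \<open>The gains are nonpositive, so lowering the weights to \<open>p_min\<close> can
      only enlarge the sum.\<close>
    also have "(\<Sum>i\<in>UNIV. p i * block_gain \<nu> y i) \<le> (\<Sum>i\<in>UNIV. p_min * block_gain \<nu> y i)"
      using gain_nonpos[OF y] pm by (intro sum_mono mult_right_mono_neg)
    finally show ?thesis by (simp add: sum_distrib_left)
  qed
  have \<psi>_step: "a * p_min * (D y)\<^sup>2 \<le> real_objective y - \<psi> y" if y: "y \<in> domain" for y
  proof -
    have "(\<Sum>i\<in>UNIV. block_gain \<nu> y i) \<le> (\<Sum>i\<in>UNIV. - (a * (1 / \<gamma> i * (norm (step y $ i))\<^sup>2)))"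
      unfolding a_def by (intro sum_mono block_gain_le_step y \<delta>)
    also have "\<dots> = - (a * (D y)\<^sup>2)"
      unfolding D_def wnorm_power2[of "\<lambda>i. 1 / \<gamma> i", OF g0] by (simp only: sum_negf sum_distrib_left)
    finally have "p_min * (\<Sum>i\<in>UNIV. block_gain \<nu> y i) \<le> p_min * - (a * (D y)\<^sup>2)"
      using pm0 by (intro mult_left_mono) auto
    then show ?thesis using \<psi>_le[OF y] by (simp add: algebra_simps)
  qed
  have \<psi>_rate: "\<psi> y - m \<le> rate * (real_objective y - m)" if y: "y \<in> domain" "y \<in> X" for y
  proof -
    have "(\<Sum>i\<in>UNIV. block_gain \<nu> y i) \<le> - (\<kappa> * (real_objective y - m))"
      unfolding \<kappa>_def using \<delta>2 S_min S_dom S_val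
      by (intro sum_block_gain_le_error_bound[where \<nu> = \<nu>, OF y(1) \<delta> _ c _ _ _ error_bound[OF y(2)]]) auto
    then have "p_min * (\<Sum>i\<in>UNIV. block_gain \<nu> y i) \<le> p_min * - (\<kappa> * (real_objective y - m))"
      using pm0 by (intro mult_left_mono) auto
    then show ?thesis using \<psi>_le[OF y(1)] by (simp add: rate algebra_simps)
  qed

  \<comment> \<open>Decay of the expected objective gap\<close>
  define E where "E n = expectation (\<lambda>\<omega>. real_objective (x n \<omega>) - m)" for n
  have E_nonneg: "0 \<le> E n" for n
    unfolding E_def using dom m_le by (intro Bochner_Integration.integral_nonneg) auto
  have E_eq: "E n = expectation (\<lambda>\<omega>. real_objective (x n \<omega>)) - m" for n
    unfolding E_def using int_x by (simp add: prob_space)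
  have E_Suc: "E (Suc n) = expectation (\<lambda>\<omega>. \<psi> (x n \<omega>) - m)" for n
  proof -
    have "expectation (\<lambda>\<omega>. real_objective (x (Suc n) \<omega>))
        = expectation (\<lambda>\<omega>. real_objective (\<Phi> (x n \<omega>) (eps n \<omega>)))"
      by (intro Bochner_Integration.integral_cong) (auto simp: x_Suc')
    also have "\<dots> = expectation (\<lambda>\<omega>. \<psi> (x n \<omega>))"
      unfolding \<psi>_def by (rule step_expectation)
    finally show ?thesis unfolding E_eq using int_x by (simp add: prob_space)
  qed
  have E_step: "E (Suc n) \<le> rate * E n" for n
  proof -
    have "E (Suc n) \<le> expectation (\<lambda>\<omega>. rate * (real_objective (x n \<omega>) - m))"
      unfolding E_Suc
    proof (rule integral_mono_AE)
      \<comment> \<open>Membership of the iterates in \<open>X\<close>, and with it the error bound,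
        is given almost surely only.\<close>
      show "AE \<omega> in M. \<psi> (x n \<omega>) - m \<le> rate * (real_objective (x n \<omega>) - m)"
        using X(2) AE_space by eventually_elim (use dom \<psi>_rate in auto)
    qed (use int_x[of "\<lambda>y. \<psi> y - m"] int_x[of "\<lambda>y. rate * (real_objective y - m)"] in auto)
    then show ?thesis unfolding E_def by simp
  qed
  have E_rate: "E n \<le> rate ^ n * E 0" for n
  proof (induction n)
    case (Suc n)
    have "E (Suc n) \<le> rate * (rate ^ n * E 0)"
      using E_step[of n] mult_left_mono[OF Suc rate0] by linarith
    then show ?case by (simp add: mult.assoc)
  qed simp
  have exp_F: "ereal_expectation M (\<lambda>\<omega>. F (x n \<omega>)) - F_min = ereal (E n)" for n
  proof -
    have "ereal_expectation M (\<lambda>\<omega>. F (x n \<omega>)) = ereal (expectation (\<lambda>\<omega>. real_objective (x n \<omega>)))"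
      using dom by (intro ereal_expectation_ereal int_x) (auto simp: F objective_real)
    then show ?thesis by (simp add: F_min E_eq)
  qed

  \<comment> \<open>Expected size of the increments\<close>
  define d where "d n \<omega> = wnorm W (\<Phi> (x n \<omega>) (eps n \<omega>) - x n \<omega>)" for n \<omega>
  have d_nonneg: "0 \<le> d n \<omega>" for n \<omega> unfolding d_def by (rule wnorm_nonneg[OF W0])
  \<comment> \<open>The increment is a function of the finitely valued pair of iterate and
    selection, so its composition with any \<open>g\<close> is integrable.\<close>
  have int_d: "integrable M (\<lambda>\<omega>. g (d n \<omega>))" for g :: "real \<Rightarrow> real" and n
    using integrable_finite_range[OF measurable_pair_finite[OF iter(1)[of n] eps_meas[of n]],
        of "x n ` space M \<times> UNIV" "\<lambda>(y, e). g (wnorm W (\<Phi> y e - y))"] iter(2)[of n]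
    by (auto simp: d_def)
  define q where "q = sqrt rate"
  have q: "0 \<le> q" "q < 1" using rate0 rate1 by (auto simp: q_def)
  \<comment> \<open>The mean square of \<open>d n\<close>, times \<open>a * p_min\<close>, is at
    most \<open>E n - E (Suc n)\<close>, hence at most \<open>rate ^ n * E 0\<close>; taking roots
    gives \<open>C * q ^ n\<close>.\<close>
  define C where "C = sqrt (E 0 / (a * p_min))"
  have C: "0 \<le> C" using E_nonneg a pm0 by (simp add: C_def)
  have step_power2: "(\<integral>\<omega>. (wnorm W (\<Phi> y (\<epsilon> \<omega>) - y))\<^sup>2 \<partial>M) = (D y)\<^sup>2" for y
  proof -
    have "\<Phi> y e - y = e \<odot> step y" for e by (simp add: \<Phi>_def)
    then show ?thesis
      unfolding D_def W_def[abs_def] using \<epsilon>(2)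
      by (simp only:) (rule expected_step_power2[OF M \<epsilon>(1)], simp_all only: p_def)
  qed
  have d_le: "expectation (d n) \<le> C * q ^ n" for n
  proof -
    have "expectation (\<lambda>\<omega>. (d n \<omega>)\<^sup>2)
        = expectation (\<lambda>\<omega>. (\<integral>\<omega>'. (wnorm W (\<Phi> (x n \<omega>) (\<epsilon> \<omega>') - x n \<omega>))\<^sup>2 \<partial>M))"
      unfolding d_def by (rule step_expectation)
    also have "\<dots> = expectation (\<lambda>\<omega>. (D (x n \<omega>))\<^sup>2)"
      by (simp only: step_power2)
    finally have "a * p_min * expectation (\<lambda>\<omega>. (d n \<omega>)\<^sup>2) = expectation (\<lambda>\<omega>. a * p_min * (D (x n \<omega>))\<^sup>2)"
      by simp
    also have "\<dots> \<le> expectation (\<lambda>\<omega>. (real_objective (x n \<omega>) - m) - (\<psi> (x n \<omega>) - m))"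
    proof (rule integral_mono)
      show "integrable M (\<lambda>\<omega>. a * p_min * (D (x n \<omega>))\<^sup>2)"
        by (rule int_x[of "\<lambda>y. a * p_min * (D y)\<^sup>2"])
      show "integrable M (\<lambda>\<omega>. (real_objective (x n \<omega>) - m) - (\<psi> (x n \<omega>) - m))"
        by (rule int_x[of "\<lambda>y. (real_objective y - m) - (\<psi> y - m)"])
    qed (use \<psi>_step dom in auto)
    also have "\<dots> = E n - E (Suc n)"
      unfolding E_Suc E_def[of n]
      by (intro Bochner_Integration.integral_diff int_x[of "\<lambda>y. real_objective y - m"] int_x[of "\<lambda>y. \<psi> y - m"])
    also have "\<dots> \<le> rate ^ n * E 0" using E_rate[of n] E_nonneg[of "Suc n"] by linarith
    finally have "expectation (\<lambda>\<omega>. (d n \<omega>)\<^sup>2) \<le> E 0 / (a * p_min) * rate ^ n"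
      using a pm0 by (simp add: field_simps)
    then have "sqrt (expectation (\<lambda>\<omega>. (d n \<omega>)\<^sup>2)) \<le> C * q ^ n"
      unfolding C_def q_def by (metis real_sqrt_le_iff real_sqrt_mult real_sqrt_power)
    moreover have "expectation (d n) \<le> sqrt (expectation (\<lambda>\<omega>. (d n \<omega>)\<^sup>2))"
      using int_d[of "\<lambda>t. t"] int_d[of "\<lambda>t. t\<^sup>2"] by (intro expectation_le_sqrt) auto
    ultimately show ?thesis by linarith
  qed
  have d_exp_nonneg: "0 \<le> expectation (d n)" for n
    using d_nonneg by (intro Bochner_Integration.integral_nonneg) auto
  \<comment> \<open>The tail of a geometric series; its factor \<open>C / (1 - q)\<close> becomes
    the constant in the final order bound.\<close>
  have geo: "(\<lambda>k. C * q ^ (k + n)) sums (C * q ^ n / (1 - q))" for n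
    using sums_mult[OF geometric_sums[of q], of "C * q ^ n"] q by (simp add: power_add mult_ac)
  have sm_d: "summable (\<lambda>k. expectation (d (k + n)))" for n
    using d_exp_nonneg d_le by (intro summable_comparison_test[OF _ sums_summable[OF geo[of n]]]) auto
  have "summable (\<lambda>n. rate ^ n * E 0)"
    using rate0 rate1 by (intro summable_mult2 summable_geometric) auto
  then have sm_E: "summable E"
    by (rule summable_comparison_test[rotated]) (use E_nonneg E_rate in auto)
  \<comment> \<open>In \<open>ennreal\<close> the tail series has a value at every outcome, so its
    expectation can be bounded before pointwise summability is known.\<close>
  have tail: "(\<integral>\<^sup>+\<omega>. (\<Sum>k. ennreal (d (k + n) \<omega>)) \<partial>M) \<le> ennreal (C * q ^ n / (1 - q))" for n
  proof -
    have "(\<integral>\<^sup>+\<omega>. (\<Sum>k. ennreal (d (k + n) \<omega>)) \<partial>M) = ennreal (\<Sum>k. expectation (d (k + n)))"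
      using int_d[of "\<lambda>t. t"] d_nonneg sm_d by (intro nn_integral_suminf_real) auto
    also have "\<dots> \<le> ennreal (C * q ^ n / (1 - q))"
      using suminf_le[OF d_le sm_d sums_summable[OF geo]] sums_unique[OF geo, of n]
      by (intro ennreal_leI) simp
    finally show ?thesis .
  qed

  \<comment> \<open>Almost sure convergence to a minimizer\<close>
  define good where "good \<omega> z \<longleftrightarrow> (\<lambda>n. x n \<omega>) \<longlonglongrightarrow> z \<and> z \<in> S_min \<and>
    (\<forall>n. ennreal (wnorm W (x n \<omega> - z)) \<le> (\<Sum>k. ennreal (d (k + n) \<omega>)))" for \<omega> z
  have "AE \<omega> in M. summable (\<lambda>n. d n \<omega>)"
    using int_d[of "\<lambda>t. t"] d_nonneg sm_d[of 0] by (intro AE_summable) auto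
  \<comment> \<open>Summability of the expected gaps, stronger than their convergence to 0, gives
    almost sure convergence of the objective values along the whole sequence.\<close>
  moreover have "AE \<omega> in M. summable (\<lambda>n. real_objective (x n \<omega>) - m)"
    using int_x[of "\<lambda>y. real_objective y - m"] dom m_le sm_E
    by (intro AE_summable) (auto simp: E_def[abs_def])
  ultimately have AE_good: "AE \<omega> in M. \<exists>z. good \<omega> z"
    using AE_space
  proof eventually_elim
    case (elim \<omega>)
    let ?u = "\<lambda>n. block_scale W (x n \<omega>)"
    have nd: "norm (?u (Suc n) - ?u n) = d n \<omega>" for n
      using x_Suc'[OF elim(3)] by (simp add: d_def wnorm_eq_norm[OF W0] block_scale_diff)
    \<comment> \<open>Convergence is obtained in the scaled coordinates, where the increments have
      norm \<open>d n \<omega>\<close>, and is then scaled back.\<close>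
    obtain l where l: "?u \<longlonglongrightarrow> l" "\<And>n. norm (?u n - l) \<le> (\<Sum>k. d (k + n) \<omega>)"
      using summable_increments_convergent[of ?u] elim(1) unfolding nd by blast
    obtain z where z: "(\<lambda>n. x n \<omega>) \<longlonglongrightarrow> z" "block_scale W z = l"
      using tendsto_block_scale_cancel[OF l(1) W] by blast
    have xH: "x n \<omega> \<in> direct_sum V" for n using dom[OF elim(3)] by (simp add: domain_def)
    note lsc = objective_lsc[OF xH z(1)]
    have "(\<lambda>n. real_objective (x n \<omega>) - m + m) \<longlonglongrightarrow> 0 + m"
      by (intro tendsto_add summable_LIMSEQ_zero[OF elim(2)] tendsto_const)
    then have "liminf (\<lambda>n. objective (x n \<omega>)) = ereal m"
      unfolding objective_real[OF dom[OF elim(3)]] by (intro lim_imp_Liminf) auto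
    then have "objective z \<le> objective y" if "y \<in> H" for y
      using lsc(2) objective_infinite[of y] objective_real[of y] m_le[of y] that
      by (cases "y \<in> domain") (auto simp: H_def intro: order_trans)
    then have "z \<in> S_min" using lsc(1) by (simp add: S_iff H_def)
    moreover have "ennreal (wnorm W (x n \<omega> - z)) \<le> (\<Sum>k. ennreal (d (k + n) \<omega>))" for n
    proof -
      have "wnorm W (x n \<omega> - z) \<le> (\<Sum>k. d (k + n) \<omega>)"
        using l(2)[of n] z(2) by (simp add: wnorm_eq_norm[OF W0] block_scale_diff)
      moreover have "(\<Sum>k. ennreal (d (k + n) \<omega>)) = ennreal (\<Sum>k. d (k + n) \<omega>)"
        using summable_ignore_initial_segment[OF elim(1), of n] d_nonneg by (intro suminf_ennreal2) auto
      ultimately show ?thesis by (simp add: ennreal_leI)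
    qed
    ultimately show ?case using z(1) unfolding good_def by blast
  qed
  \<comment> \<open>The set of bad outcomes need not be measurable; \<open>N\<close> is a measurable
    null set that covers it.\<close>
  then obtain N where N: "{\<omega> \<in> space M. \<not> (\<exists>z. good \<omega> z)} \<subseteq> N" "N \<in> null_sets M"
    by (auto simp: eventually_ae_filter)
  \<comment> \<open>The default \<open>s0\<close> keeps the values on \<open>N\<close> inside
    \<open>S_min\<close> as well.\<close>
  define xs where "xs \<omega> = (if \<omega> \<in> N then s0 else (SOME z. good \<omega> z))" for \<omega>
  have good_xs: "good \<omega> (xs \<omega>)" if "\<omega> \<in> space M" "\<omega> \<notin> N" for \<omega>
  proof -
    have "\<exists>z. good \<omega> z" using N(1) that by blast
    from someI_ex[OF this] show ?thesis using that by (simp add: xs_def)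
  qed
  have AE_N: "AE \<omega> in M. \<omega> \<in> space M \<and> \<omega> \<notin> N"
    using AE_not_in[OF N(2)] AE_space by eventually_elim auto
  have x_borel: "x n \<in> borel_measurable M" for n
    using measurable_compose[OF iter(1)[of n], of "\<lambda>y. y" borel] by simp
  have N_sets: "N \<in> sets M" using N(2) by auto
  have xs_borel: "xs \<in> borel_measurable M"
  \<comment> \<open>The choice operator in \<open>xs\<close> gives no measurability by itself. The
    iterates, replaced by \<open>s0\<close> on \<open>N\<close>, converge to \<open>xs\<close> at
    every outcome.\<close>
  proof (rule borel_measurable_LIMSEQ_metric)
    show "(\<lambda>\<omega>. if \<omega> \<in> N then s0 else x n \<omega>) \<in> borel_measurable M" for n
      using N_sets x_borel by (intro measurable_If_set) auto
    show "(\<lambda>n. if \<omega> \<in> N then s0 else x n \<omega>) \<longlonglongrightarrow> xs \<omega>" if "\<omega> \<in> space M" for \<omega>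
    proof (cases "\<omega> \<in> N")
      case True
      then show ?thesis by (simp add: xs_def)
    next
      case False
      then show ?thesis using good_xs[OF that False] by (simp add: good_def)
    qed
  qed
  have xs_S: "xs \<omega> \<in> S_min" if "\<omega> \<in> space M" for \<omega>
  proof (cases "\<omega> \<in> N")
    case True
    then show ?thesis using s0 by (simp add: xs_def)
  next
    case False
    then show ?thesis using good_xs[OF that False] by (simp add: good_def)
  qed
  have xs_lim: "AE \<omega> in M. (\<lambda>n. x n \<omega>) \<longlonglongrightarrow> xs \<omega>"
    using AE_N by eventually_elim (use good_xs in \<open>auto simp: good_def\<close>)

  \<comment> \<open>Rate for the expected distance to the limit\<close>
  have meas: "(\<lambda>\<omega>. wnorm W (x n \<omega> - xs \<omega>)) \<in> borel_measurable M" for n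
  proof -
    have nth: "(\<lambda>\<omega>. u \<omega> $ i) \<in> borel_measurable M" if "u \<in> borel_measurable M" for u :: "'w \<Rightarrow> 'a ^ 'm" and i
      by (rule measurable_compose[OF that borel_measurable_continuous_onI]) (intro continuous_intros)
    note [measurable] = nth[OF x_borel] nth[OF xs_borel]
    show ?thesis unfolding wnorm_def vector_minus_component by measurable
  qed
  have nn: "(\<integral>\<^sup>+\<omega>. ennreal (wnorm W (x n \<omega> - xs \<omega>)) \<partial>M) \<le> ennreal (C * q ^ n / (1 - q))" for n
  proof (rule order_trans[OF nn_integral_mono_AE tail])
    show "AE \<omega> in M. ennreal (wnorm W (x n \<omega> - xs \<omega>)) \<le> (\<Sum>k. ennreal (d (k + n) \<omega>))"
      using AE_N by eventually_elim (use good_xs in \<open>auto simp: good_def\<close>)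
  qed
  have int_xs: "integrable M (\<lambda>\<omega>. wnorm W (x n \<omega> - xs \<omega>))" for n
    using nn[of n] wnorm_nonneg[of W, OF W0]
    by (intro integrableI_nonneg meas) (auto intro: le_less_trans)
  have dist_le: "expectation (\<lambda>\<omega>. wnorm W (x n \<omega> - xs \<omega>)) \<le> C / (1 - q) * q ^ n" for n
  proof -
    have "ennreal (expectation (\<lambda>\<omega>. wnorm W (x n \<omega> - xs \<omega>))) \<le> ennreal (C * q ^ n / (1 - q))"
      using nn[of n] nn_integral_eq_integral[OF int_xs[of n] AE_I2[OF wnorm_nonneg[of W, OF W0]]] by simp
    then show ?thesis using C q by (simp add: ennreal_le_iff)
  qed
  \<comment> \<open>False for \<open>n = 0\<close> and \<open>rate = 0\<close>, because \<open>0 powr 0 = 0\<close>.\<close>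
  have q_powr: "rate powr (real n / 2) = q ^ n" if "n \<ge> 1" for n
  proof (cases "rate = 0")
    case True
    then show ?thesis using that by (simp add: q_def)
  next
    case False
    then have r: "0 < rate" using rate0 by simp
    have "rate powr (real n / 2) = (rate powr (1 / 2)) powr real n" by (simp add: powr_powr)
    also have "\<dots> = q ^ n" using r by (simp add: powr_half_sqrt powr_realpow q_def)
    finally show ?thesis .
  qed
  have "(\<lambda>n. expectation (\<lambda>\<omega>. wnorm W (x n \<omega> - xs \<omega>))) \<in> O(\<lambda>n. rate powr (real n / 2))"
  proof (rule bigoI[where c = "C / (1 - q)"])
    show "\<forall>\<^sub>F n in sequentially. norm (expectation (\<lambda>\<omega>. wnorm W (x n \<omega> - xs \<omega>)))
        \<le> C / (1 - q) * norm (rate powr (real n / 2))"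
      using eventually_ge_at_top[of 1]
    proof eventually_elim
      case (elim n)
      have "0 \<le> expectation (\<lambda>\<omega>. wnorm W (x n \<omega> - xs \<omega>))"
        using wnorm_nonneg[of W, OF W0] by (intro Bochner_Integration.integral_nonneg) auto
      then show ?case using dist_le[of n] q_powr[OF elim] q by simp
    qed
  qed
  then show ?thesis
    using exp_F E_rate xs_borel xs_S xs_lim int_xs unfolding W_def[abs_def] by auto
qed

end
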